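(* Let $\kappa>0$, let $A,C,Q\in\mathbb{R}^{n\times n}$, $B,N\in\mathbb{R}^{n\times m}$, $R\in\mathbb{R}^{m\times m}$, $b\in\mathbb{R}^n$, with $Q$ symmetric positive-semidefinite and $R$ symmetric positive-definite, and set $$\tilde Q=Q-NR^{-1}N^\top,\qquad \tilde A=A-BR^{-1}N^\top,\qquad \tilde R=BR^{-1}B^\top.$$ Consider on $[0,\kappa]$ the periodic Riccati problem $$\dot S=-\tilde A^\top S-S\tilde A+S\tilde RS-\tilde Q,\qquad S(\kappa)=C^\top S(0)C,\tag{i}$$ and the associated problem $$\dot c=\left[-\tilde A^\top+S(t)\tilde R\right]c-S(t)b,\qquad c(\kappa)=C^\top c(0).\tag{ii}$$ Consider the matrices $$Z=\begin{bmatrix}\tilde A & -\tilde R\\ -\tilde Q & -\tilde A^\top\end{bmatrix},\qquad \begin{bmatrix}P_{11}&P_{12}\\P_{21}&P_{22}\end{bmatrix}=e^{Z\kappa}.$$ (1) Solutions $S$ of (i) correspond, with $S_0=S(0)$, to solutions $S_0$ of $$C^\top S_0C\left[P_{11}+P_{12}S_0\right]=P_{21}+P_{22}S_0.\tag{iii}$$ (2) Let $\Phi(t,s)$ be the fundamental matrix solution of $$\frac{\partial}{\partial t}\Phi(t,s)=\left[-\tilde A^\top+S(t)\tilde R\right]\Phi(t,s),\qquad \Phi(s,s)=\mathrm{Id}.$$ Then solutions of (ii) can be found, with $c_0=c(0)$, by $$c_0=\left[\Phi(\kappa,0)-C^\top\right]^{-1}\int_0^\kappa\Phi(\kappa,\tau)S(\tau)b\,d\tau,$$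 assuming that $\Phi(\kappa,0)-C^\top$ is invertible. (3) Moreover, if $$\mathrm{rank}\left[Ce^{A\kappa}-s\cdot\mathrm{Id},\,B,\,AB,\,A^2B,\dots,A^{n-1}B\right]=n\quad\text{for all }s\in\mathbb{C}\text{ with }|s|\ge1,$$ then (iii) admits a solution.
   Context: The problem arises from minimizing $\frac12\int(x^\top Qx+u^\top Ru+2x^\top Nu)\,dt$ plus a terminal cost, subject to $\dot x=Ax+Bu+b$ for $t\notin\kappa\mathbb{Z}$ and $x(t^+)=Cx(t)$ for $t\in\kappa\mathbb{Z}$. The blocks $P_{ij}$ of $e^{Z\kappa}$ are $n\times n$. In (2), $S(t)$ is a solution of (i).
   Formalization: Part (3), and in (1) the claim that a solution S₀ of (iii) comes from a solution S of (i), are proved assuming the running cost xᵀQx+uᵀRu+2xᵀNu is nonnegative for all x,u; that claim in (1) also assumes S₀ symmetric. Both claims are false as stated without these. *)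

theory Defs
  imports "HOL-Analysis.Analysis"
begin

definition symmetric_mat :: "real^'n^'n \<Rightarrow> bool" where
  "symmetric_mat M \<longleftrightarrow> transpose M = M"

definition psd_mat :: "real^'n^'n \<Rightarrow> bool" where
  "psd_mat M \<longleftrightarrow> symmetric_mat M \<and> (\<forall>x. 0 \<le> x \<bullet> (M *v x))"

definition pd_mat :: "real^'n^'n \<Rightarrow> bool" where
  "pd_mat M \<longleftrightarrow> symmetric_mat M \<and> (\<forall>x. x \<noteq> 0 \<longrightarrow> 0 < x \<bullet> (M *v x))"

(* The type class operations on vectors and matrices (times, power, exp) are
   componentwise or unavailable, so powers and the exponential with respect to
   the matrix product are introduced here. *)
primrec mat_power :: "'a::semiring_1^'n^'n \<Rightarrow> nat \<Rightarrow> 'a^'n^'n" where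
  "mat_power M 0 = mat 1"
| "mat_power M (Suc k) = M ** mat_power M k"

definition mat_exp :: "real^'n^'n \<Rightarrow> real^'n^'n" where
  "mat_exp M = (\<Sum>k. (1 / fact k) *\<^sub>R mat_power M k)"

(* Square block matrices of order 2n are indexed by 'n + 'n, with Inl for the
   first and Inr for the second block of n indices. *)
definition block_mat ::
  "'a^'n^'n \<Rightarrow> 'a^'n^'n \<Rightarrow> 'a^'n^'n \<Rightarrow> 'a^'n^'n \<Rightarrow> 'a^('n + 'n)^('n + 'n)" where
  "block_mat M11 M12 M21 M22 = (\<chi> i j.
     (case i of
        Inl k \<Rightarrow> (case j of Inl l \<Rightarrow> M11 $ k $ l | Inr l \<Rightarrow> M12 $ k $ l)
      | Inr k \<Rightarrow> (case j of Inl l \<Rightarrow> M21 $ k $ l | Inr l \<Rightarrow> M22 $ k $ l)))"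

(* On [0,\<kappa>] derivatives are taken within the interval, that is, they are
   one-sided at the end points. *)
definition riccati_ode ::
  "real \<Rightarrow> real^'n^'n \<Rightarrow> real^'n^'n \<Rightarrow> real^'n^'n \<Rightarrow> (real \<Rightarrow> real^'n^'n) \<Rightarrow> bool" where
  "riccati_ode \<kappa> At Rt Qt S \<longleftrightarrow> (\<forall>t\<in>{0..\<kappa>}.
     (S has_vector_derivative
        (- (transpose At ** S t) - S t ** At + S t ** Rt ** S t - Qt)) (at t within {0..\<kappa>}))"

definition periodic_riccati ::
  "real \<Rightarrow> real^'n^'n \<Rightarrow> real^'n^'n \<Rightarrow> real^'n^'n \<Rightarrow> real^'n^'n \<Rightarrow> (real \<Rightarrow> real^'n^'n) \<Rightarrow> bool" where
  "periodic_riccati \<kappa> At Rt Qt C S \<longleftrightarrow>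
     riccati_ode \<kappa> At Rt Qt S \<and> S \<kappa> = transpose C ** S 0 ** C"

definition periodic_linear ::
  "real \<Rightarrow> real^'n^'n \<Rightarrow> real^'n^'n \<Rightarrow> real^'n^'n \<Rightarrow> real^'n \<Rightarrow> (real \<Rightarrow> real^'n^'n)
     \<Rightarrow> (real \<Rightarrow> real^'n) \<Rightarrow> bool" where
  "periodic_linear \<kappa> At Rt C b S c \<longleftrightarrow>
     (\<forall>t\<in>{0..\<kappa>}.
       (c has_vector_derivative ((- transpose At + S t ** Rt) *v c t - S t *v b))
         (at t within {0..\<kappa>})) \<and>
     c \<kappa> = transpose C *v c 0"

definition fundamental_matrix ::
  "real \<Rightarrow> (real \<Rightarrow> real^'n^'n) \<Rightarrow> (real \<Rightarrow> real \<Rightarrow> real^'n^'n) \<Rightarrow> bool" where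
  "fundamental_matrix \<kappa> M \<Phi> \<longleftrightarrow> (\<forall>s\<in>{0..\<kappa>}.
     \<Phi> s s = mat 1 \<and>
     (\<forall>t\<in>{0..\<kappa>}.
       ((\<lambda>t. \<Phi> t s) has_vector_derivative (M t ** \<Phi> t s)) (at t within {0..\<kappa>})))"

definition algebraic_periodic_riccati ::
  "real^'n^'n \<Rightarrow> real^'n^'n \<Rightarrow> real^'n^'n \<Rightarrow> real^'n^'n \<Rightarrow> real^'n^'n \<Rightarrow> real^'n^'n \<Rightarrow> bool" where
  "algebraic_periodic_riccati C P11 P12 P21 P22 S0 \<longleftrightarrow>
     transpose C ** S0 ** C ** (P11 + P12 ** S0) = P21 + P22 ** S0"

(* The matrix [C e^(A \<kappa>) - s Id, B, A B, ..., A^(n-1) B].  Its columns are indexed by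
   'n + 'n \<times> 'm: Inl l is column l of the first block, Inr (k, l) is column l of
   A^j B, where j runs through 0, ..., n-1 as k runs through 'n because
   to_nat_on UNIV is a bijection from 'n onto {..<n}.  The arbitrary order of the
   blocks does not affect the rank. *)
definition hautus_mat ::
  "real \<Rightarrow> real^'n^'n \<Rightarrow> real^'m^'n \<Rightarrow> real^'n^'n \<Rightarrow> complex \<Rightarrow> complex^('n + 'n \<times> 'm)^'n" where
  "hautus_mat \<kappa> A B C s = (\<chi> i j.
     (case j of
        Inl l \<Rightarrow> (map_matrix complex_of_real (C ** mat_exp (\<kappa> *\<^sub>R A)) - mat s) $ i $ l
      | Inr (k, l) \<Rightarrow>
          complex_of_real ((mat_power A (to_nat_on (UNIV :: 'n set) k) ** B) $ i $ l)))"

(* Nonnegativity of the running cost x' Q x + u' R u + 2 x' N u, jointly in (x,u).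
   For positive definite R it says that Q - N R^(-1) N' is positive-semidefinite.
   It does not follow from Q being positive-semidefinite and R positive definite:
   for n = m = 1, Q = 0, R = N = B = A = 1, C = 0, \<kappa> = \<pi>/2, the algebraic equation
   reads 0 = 1. *)
definition nonneg_cost :: "real^'n^'n \<Rightarrow> real^'m^'m \<Rightarrow> real^'m^'n \<Rightarrow> bool" where
  "nonneg_cost Q R N \<longleftrightarrow>
     (\<forall>x u. 0 \<le> x \<bullet> (Q *v x) + u \<bullet> (R *v u) + 2 * (x \<bullet> (N *v u)))"

end

theory Submission
  imports Defs "HOL-Computational_Algebra.Fundamental_Theorem_Algebra"
begin

text \<open>
  The Riccati equation is linearised by \<open>S = Y X\<^sup>-\<^sup>1\<close>, where \<open>(X, Y)\<close> solves the Hamiltonian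
  system with matrix \<open>Z\<close>; the algebraic equation is the terminal condition read off from \<open>e\<^sup>Z\<^sup>\<kappa>\<close>.
  Conversely a symmetric solution of the algebraic equation yields a solution on all of \<open>[0,\<kappa>]\<close>,
  because the form \<open>X\<^sup>T Y\<close> decreases in time: a singular \<open>X(t)\<close> would raise its negative index,
  whereas its value at \<open>\<kappa>\<close> is a pullback of its value \<open>S\<^sub>0\<close> at \<open>0\<close>.

  For the solvability, iterate \<open>G \<mapsto> Ric(C\<^sup>T G C)\<close> from \<open>0\<close>, where \<open>Ric(T)\<close> is the optimal cost over
  one period with terminal cost \<open>T\<close>. The iterates increase, so a limit exists as soon as the set \<open>W\<close>
  of states of bounded cost is everything. A dimension count shows that \<open>W\<close> is invariant and
  contains the reachable states. By the rank condition, the eigenvalues of \<open>C e\<^sup>A\<^sup>\<kappa>\<close> modulo \<open>W\<close> lie in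
  the open unit disc, and along a generalised eigenvector of such an eigenvalue the cost obeys a
  contracting recursion, so that vector belongs to \<open>W\<close> as well.
\<close>

section \<open>Bilinear products and linear differential equations\<close>

text \<open>The cross term \<open>N\<close> is the first obstacle: positivity of \<open>Q\<close>
  and \<open>R\<close> does not make \<open>Qt\<close> positive, \<open>nonneg_cost\<close> does,
  and the monotonicity of the form rests on it. The second is that Riccati solutions may blow up
  before \<open>\<kappa>\<close>; the linear Hamiltonian system cannot, and blow-up becomes
  singularity of \<open>X t\<close>. The rank condition speaks of the plant matrix \<open>A\<close>,
  the Riccati equation of \<open>At\<close>. The substitution v = u + R^(-1) N' x turns one control
  problem into the other without changing the trajectories. The dimension count: put F = C e^(A
  \<kappa>), K = C (reachable states), L = W + K. If F x lies in L, one period of control and the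
  jump lead from x into W at a cost that does not depend on the iterate, so the preimage of L under
  F lies in W. A preimage has at least the dimension of the subspace, even for singular F, so the
  preimage, L and W coincide; hence K lies in W and F maps W to itself. No stabilising feedback is
  constructed.\<close>

lemma matrix_add_rdistrib:
  fixes A B :: "real^'n^'m"
  shows "(A + B) ** C = A ** C + B ** C"
  by (vector matrix_matrix_mult_def sum.distrib [symmetric] field_simps)

lemma bounded_bilinear_matrix_mult:
  "bounded_bilinear ((**) :: real^'n^'m \<Rightarrow> real^'p^'n \<Rightarrow> real^'p^'m)"
  unfolding bilinear_conv_bounded_bilinear [symmetric] bilinear_def
  by (auto intro!: linearI simp: matrix_add_ldistrib matrix_add_rdistrib scalar_matrix_assoc
      matrix_scalar_ac)

lemma bounded_bilinear_matrix_vector_mult: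
  "bounded_bilinear ((*v) :: real^'n^'m \<Rightarrow> real^'n \<Rightarrow> real^'m)"
  unfolding bilinear_conv_bounded_bilinear [symmetric] bilinear_def
  by (auto intro!: linearI simp: matrix_vector_mult_add_rdistrib matrix_vector_right_distrib
      scaleR_matrix_vector_assoc matrix_vector_mult_scaleR)

lemmas has_vector_derivative_matrix_mult =
  bounded_bilinear.has_vector_derivative [OF bounded_bilinear_matrix_mult]

lemmas has_vector_derivative_matrix_vector_mult =
  bounded_bilinear.has_vector_derivative [OF bounded_bilinear_matrix_vector_mult]

lemmas continuous_on_matrix_mult =
  bounded_bilinear.continuous_on [OF bounded_bilinear_matrix_mult]

lemmas continuous_on_matrix_vector_mult =
  bounded_bilinear.continuous_on [OF bounded_bilinear_matrix_vector_mult]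

lemmas matrix_mult_uminus_left = bounded_bilinear.minus_left [OF bounded_bilinear_matrix_mult]
lemmas matrix_mult_uminus_right = bounded_bilinear.minus_right [OF bounded_bilinear_matrix_mult]
lemmas matrix_vector_mult_uminus_left =
  bounded_bilinear.minus_left [OF bounded_bilinear_matrix_vector_mult]
lemmas matrix_vector_mult_uminus_right =
  bounded_bilinear.minus_right [OF bounded_bilinear_matrix_vector_mult]

lemma has_vector_derivative_inner:
  fixes f g :: "real \<Rightarrow> 'a::real_inner"
  assumes "(f has_vector_derivative f') (at t within s)"
    and "(g has_vector_derivative g') (at t within s)"
  shows "((\<lambda>t. f t \<bullet> g t) has_real_derivative (f' \<bullet> g t + f t \<bullet> g')) (at t within s)"
  using bounded_bilinear.has_vector_derivative [OF bounded_bilinear_inner assms]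
  by (simp add: has_real_derivative_iff_has_vector_derivative add.commute)

lemma inner_matrix_vector_transpose:
  fixes M :: "real^'n^'m"
  shows "x \<bullet> (M *v y) = (transpose M *v x) \<bullet> y"
  by (simp add: dot_lmul_matrix transpose_matrix_vector)

lemma symmetric_mat_inner: "symmetric_mat M \<Longrightarrow> x \<bullet> (M *v y) = (M *v x) \<bullet> y"
  by (simp add: inner_matrix_vector_transpose symmetric_mat_def)

section \<open>Monotonicity from derivatives, and uniqueness for linear equations\<close>

lemma derivative_zero_imp_eq:
  fixes f :: "real \<Rightarrow> 'a::real_normed_vector"
  assumes "\<And>t. t \<in> {a..b} \<Longrightarrow> (f has_vector_derivative 0) (at t within {a..b})"
    and "s \<in> {a..b}" "t \<in> {a..b}"
  shows "f s = f t"
proof (rule has_derivative_zero_unique [of "{a..b}"])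
  show "(f has_derivative (\<lambda>h. 0)) (at x within {a..b})" if "x \<in> {a..b}" for x
    using assms(1)[OF that] by (simp add: has_vector_derivative_def)
qed (use assms in auto)

lemma derivative_nonpos_imp_le:
  fixes f :: "real \<Rightarrow> real"
  assumes f: "\<And>t. t \<in> {a..b} \<Longrightarrow> (f has_real_derivative f' t) (at t within {a..b})"
    and le: "\<And>t. t \<in> {a..b} \<Longrightarrow> f' t \<le> 0" and "a \<le> b"
  shows "f b \<le> f a"
proof -
  have "\<exists>x\<in>{a..b}. f b - f a = (\<lambda>h. h * f' x) (b - a)"
    using f by (intro mvt_very_simple \<open>a \<le> b\<close>)
      (auto simp: has_field_derivative_def mult_commute_abs)
  then obtain x where "x \<in> {a..b}" "f b - f a = (b - a) * f' x" by auto
  then show ?thesis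
    using le[of x] \<open>a \<le> b\<close> by (smt (verit, best) mult_nonneg_nonpos)
qed

text \<open>|w|^2 exp(-2 L t) is nonincreasing and |w|^2 exp(2 L t) is nondecreasing, so a zero at
  \<open>s\<close> spreads in both directions. Both are used: the known value sits at time 0 in some
  arguments and at a later time in others.\<close>

lemma gronwall_zero:
  fixes w :: "real \<Rightarrow> 'a::real_inner"
  assumes w: "\<And>t. t \<in> {a..b} \<Longrightarrow> (w has_vector_derivative w' t) (at t within {a..b})"
    and bd: "\<And>t. t \<in> {a..b} \<Longrightarrow> norm (w' t) \<le> L * norm (w t)"
    and s: "s \<in> {a..b}" "w s = 0" and t: "t \<in> {a..b}"
  shows "w t = 0"
proof -
  have bd': "\<bar>w' t \<bullet> w t\<bar> \<le> L * (w t \<bullet> w t)" if "t \<in> {a..b}" for t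
  proof -
    have "\<bar>w' t \<bullet> w t\<bar> \<le> norm (w' t) * norm (w t)"
      by (rule Cauchy_Schwarz_ineq2)
    also have "\<dots> \<le> L * norm (w t) * norm (w t)"
      using bd[OF that] by (intro mult_right_mono) auto
    finally show ?thesis by (simp add: power2_norm_eq_inner[symmetric] power2_eq_square algebra_simps)
  qed
  have der: "((\<lambda>t. (w t \<bullet> w t) * exp (c * t)) has_real_derivative
      (2 * (w' t \<bullet> w t) + c * (w t \<bullet> w t)) * exp (c * t)) (at t within {a..b})"
    if "t \<in> {a..b}" for c t
    by (rule derivative_eq_intros has_vector_derivative_inner w that refl
        | simp add: inner_commute algebra_simps)+
  have "w t \<bullet> w t \<le> 0"
  proof (cases "s \<le> t")
    case True
    have "(w t \<bullet> w t) * exp (- 2 * L * t) \<le> (w s \<bullet> w s) * exp (- 2 * L * s)"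
    proof (rule derivative_nonpos_imp_le [OF _ _ True])
      fix r assume r: "r \<in> {s..t}"
      then have r': "r \<in> {a..b}" using s t by auto
      show "((\<lambda>t. (w t \<bullet> w t) * exp (- 2 * L * t)) has_real_derivative
         (2 * (w' r \<bullet> w r) + (- 2 * L) * (w r \<bullet> w r)) * exp (- 2 * L * r)) (at r within {s..t})"
        by (rule DERIV_subset [OF der [OF r']]) (use s t in auto)
      show "(2 * (w' r \<bullet> w r) + (- 2 * L) * (w r \<bullet> w r)) * exp (- 2 * L * r) \<le> 0"
        using bd'[OF r'] by (intro mult_nonpos_nonneg) auto
    qed
    then show ?thesis
      using s(2) by (metis inner_zero_left mult_zero_left neg_le_iff_le mult_le_0_iff not_exp_le_zero)
  next
    case False
    have "- ((w s \<bullet> w s) * exp (2 * L * s)) \<le> - ((w t \<bullet> w t) * exp (2 * L * t))"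
    proof (rule derivative_nonpos_imp_le [where f = "\<lambda>t. - ((w t \<bullet> w t) * exp (2 * L * t))"])
      fix r assume r: "r \<in> {t..s}"
      then have r': "r \<in> {a..b}" using s t by auto
      show "((\<lambda>t. - ((w t \<bullet> w t) * exp (2 * L * t))) has_real_derivative
         - ((2 * (w' r \<bullet> w r) + (2 * L) * (w r \<bullet> w r)) * exp (2 * L * r))) (at r within {t..s})"
        by (rule DERIV_minus, rule DERIV_subset [OF der [OF r']]) (use s t in auto)
      show "- ((2 * (w' r \<bullet> w r) + (2 * L) * (w r \<bullet> w r)) * exp (2 * L * r)) \<le> 0"
        using bd'[OF r'] by simp
    qed (use False in auto)
    then show ?thesis
      using s(2) by (metis inner_zero_left mult_zero_left neg_le_iff_le mult_le_0_iff not_exp_le_zero)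
  qed
  then show ?thesis by (metis inner_gt_zero_iff not_le)
qed

text \<open>The product is abstract so that one proof serves matrix and vector equations.
  \<open>M\<close> is bounded on the compact interval, which gives the Gronwall constant for the
  difference of two solutions.\<close>

lemma bilinear_ode_unique:
  fixes bm :: "'a::real_normed_vector \<Rightarrow> 'b::real_inner \<Rightarrow> 'b" and V W :: "real \<Rightarrow> 'b" and M :: "real \<Rightarrow> 'a"
  assumes bm: "bounded_bilinear bm"
    and V: "\<And>t. t \<in> {a..b} \<Longrightarrow> (V has_vector_derivative bm (M t) (V t)) (at t within {a..b})"
    and W: "\<And>t. t \<in> {a..b} \<Longrightarrow> (W has_vector_derivative bm (M t) (W t)) (at t within {a..b})"
    and M: "continuous_on {a..b} M"
    and s: "s \<in> {a..b}" "V s = W s" and t: "t \<in> {a..b}"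
  shows "V t = W t"
proof -
  interpret bounded_bilinear bm by (rule bm)
  obtain K where K: "K > 0" "\<And>X Y. norm (bm X Y) \<le> norm X * norm Y * K"
    using pos_bounded by blast
  have "bounded (M ` {a..b})"
    by (intro compact_imp_bounded compact_continuous_image M) auto
  then obtain m where m: "norm (M t) \<le> m" if "t \<in> {a..b}" for t
    unfolding bounded_iff by blast
  have "V t - W t = 0"
  proof (rule gronwall_zero [where w = "\<lambda>t. V t - W t" and L = "m * K", OF _ _ s(1) _ t])
    fix r assume r: "r \<in> {a..b}"
    show "((\<lambda>t. V t - W t) has_vector_derivative bm (M r) (V r - W r)) (at r within {a..b})"
      using r by (auto intro!: derivative_eq_intros V W simp: diff_right)
    have "norm (M r) * norm (V r - W r) * K \<le> m * norm (V r - W r) * K"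
      using K m r by (intro mult_right_mono) auto
    then show "norm (bm (M r) (V r - W r)) \<le> (m * K) * norm (V r - W r)"
      using K(2)[of "M r" "V r - W r"] by (simp add: algebra_simps)
  qed (use s in auto)
  then show ?thesis by simp
qed

lemmas matrix_ode_unique = bilinear_ode_unique [OF bounded_bilinear_matrix_mult]
lemmas vector_ode_unique = bilinear_ode_unique [OF bounded_bilinear_matrix_vector_mult]

section \<open>The matrix exponential and matrix inverses\<close>

lemma has_vector_derivative_matrix_componentwise:
  fixes F :: "real \<Rightarrow> real^'n^'m"
  shows "(F has_vector_derivative F') (at t within s) \<longleftrightarrow>
    (\<forall>i j. ((\<lambda>t. F t $ i $ j) has_real_derivative F' $ i $ j) (at t within s))"
proof -
  have "(F has_vector_derivative F') (at t within s) \<longleftrightarrow>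
    (\<forall>b\<in>Basis. ((\<lambda>t. F t \<bullet> b) has_derivative (\<lambda>h. (h *\<^sub>R F') \<bullet> b)) (at t within s))"
    unfolding has_vector_derivative_def
    by (rule has_derivative_componentwise_within)
  also have "\<dots> \<longleftrightarrow> (\<forall>i j. ((\<lambda>t. F t $ i $ j) has_derivative (\<lambda>h. h * F' $ i $ j)) (at t within s))"
    by (auto simp: Basis_vec_def inner_axis)
  finally show ?thesis
    by (simp add: has_field_derivative_def mult_commute_abs)
qed

lemma mat_power_scaleR: "mat_power (t *\<^sub>R M) k = t ^ k *\<^sub>R mat_power M k" for M :: "real^'n^'n"
  by (induction k) (simp_all add: scalar_matrix_assoc [symmetric] matrix_scalar_ac)

lemma mat_power_commute: "mat_power M k ** M = M ** mat_power M k"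
  by (induction k) (simp_all add: matrix_mul_assoc [symmetric])

text \<open>The bilinear bound makes the norm submultiplicative up to a constant \<open>K\<close>,
  so the series is majorised by a multiple of the exponential series of
  \<open>norm M * K\<close>.\<close>

lemma summable_mat_exp:
  fixes M :: "real^'n^'n"
  shows "summable (\<lambda>k. (1 / fact k) *\<^sub>R mat_power M k)"
proof -
  obtain K where K: "K > 0" "\<And>(X::real^'n^'n) (Y::real^'n^'n). norm (X ** Y) \<le> norm X * norm Y * K"
    using bounded_bilinear.pos_bounded [OF bounded_bilinear_matrix_mult] by blast
  define c :: real where "c = norm (mat 1 :: real^'n^'n)"
  have bound: "norm (mat_power M k) \<le> c * (norm M * K) ^ k" for k
  proof (induction k)
    case (Suc k)
    have "norm (mat_power M (Suc k)) \<le> norm M * norm (mat_power M k) * K"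
      using K(2)[of M "mat_power M k"] by simp
    also have "\<dots> \<le> norm M * (c * (norm M * K) ^ k) * K"
      using Suc K(1) by (intro mult_right_mono mult_left_mono) auto
    finally show ?case by (simp add: mult_ac)
  qed (simp add: c_def)
  show ?thesis
  proof (rule summable_comparison_test)
    show "summable (\<lambda>k. c * (inverse (fact k) * (norm M * K) ^ k))"
      by (intro summable_mult summable_exp)
    show "\<exists>N. \<forall>k\<ge>N. norm ((1 / fact k) *\<^sub>R mat_power M k) \<le> c * (inverse (fact k) * (norm M * K) ^ k)"
      using bound by (auto simp: divide_simps mult_ac)
  qed
qed

lemma bounded_linear_mat_exp_suminf:
  fixes M :: "real^'n^'n"
  assumes "bounded_linear f"
  shows "f (mat_exp M) = (\<Sum>k. (1 / fact k) *\<^sub>R f (mat_power M k))"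
    and "summable (\<lambda>k. (1 / fact k) *\<^sub>R f (mat_power M k))"
proof -
  interpret bounded_linear f by fact
  show "f (mat_exp M) = (\<Sum>k. (1 / fact k) *\<^sub>R f (mat_power M k))"
    using suminf [OF summable_mat_exp, of M] by (simp add: mat_exp_def scaleR)
  show "summable (\<lambda>k. (1 / fact k) *\<^sub>R f (mat_power M k))"
    using summable [OF summable_mat_exp] by (simp add: scaleR)
qed

lemma mat_exp_zero [simp]: "mat_exp 0 = (mat 1 :: real^'n^'n)"
proof -
  have "(1 / fact k) *\<^sub>R mat_power (0 :: real^'n^'n) k = (if k = 0 then mat 1 else 0)" for k
    by (cases k) auto
  then have "mat_exp (0 :: real^'n^'n) = (\<Sum>k. if k = 0 then mat 1 else 0)"
    unfolding mat_exp_def by simp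
  also have "\<dots> = (\<Sum>k\<in>{0::nat}. if k = 0 then mat 1 else (0 :: real^'n^'n))"
    by (rule suminf_finite) auto
  finally show ?thesis by simp
qed

text \<open>Each entry of e^(tM) is a scalar power series in t, so termwise differentiation applies;
  the shifted coefficients belong to the same entry of M e^(tM).\<close>

lemma mat_exp_has_vector_derivative_within:
  fixes M :: "real^'n^'n"
  shows "((\<lambda>t. mat_exp (t *\<^sub>R M)) has_vector_derivative M ** mat_exp (t *\<^sub>R M)) (at t within s)"
  unfolding has_vector_derivative_matrix_componentwise
proof (intro allI)
  fix i j
  let ?pr = "\<lambda>X::real^'n^'n. X $ i $ j"
  let ?c = "\<lambda>k. mat_power M k $ i $ j / fact k"
  have pr: "bounded_linear ?pr"
    by (intro bounded_linear_compose [OF bounded_linear_vec_nth] bounded_linear_vec_nth)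
  have Mpr: "bounded_linear (\<lambda>X. ?pr (M ** X))"
    by (intro bounded_linear_compose [OF pr]
        bounded_bilinear.bounded_linear_right [OF bounded_bilinear_matrix_mult])
  have eq: "mat_exp (x *\<^sub>R M) $ i $ j = (\<Sum>k. ?c k * x ^ k)" for x
    using bounded_linear_mat_exp_suminf(1) [OF pr, of "x *\<^sub>R M"]
    by (simp add: mat_power_scaleR mult_ac)
  have "((\<lambda>x. \<Sum>k. ?c k * x ^ k) has_field_derivative (\<Sum>k. diffs ?c k * t ^ k)) (at t)"
  proof (rule termdiffs_strong_converges_everywhere)
    show "summable (\<lambda>k. ?c k * y ^ k)" for y
      using bounded_linear_mat_exp_suminf(2) [OF pr, of "y *\<^sub>R M"]
      by (simp add: mat_power_scaleR mult_ac)
  qed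
  also have "(\<Sum>k. diffs ?c k * t ^ k) = ?pr (M ** mat_exp (t *\<^sub>R M))"
    using bounded_linear_mat_exp_suminf(1) [OF Mpr, of "t *\<^sub>R M"]
    by (simp add: mat_power_scaleR matrix_scalar_ac scalar_matrix_assoc [symmetric] diffs_def
        mult_ac divide_simps del: of_nat_Suc)
  finally show "((\<lambda>t. mat_exp (t *\<^sub>R M) $ i $ j) has_real_derivative
      (M ** mat_exp (t *\<^sub>R M)) $ i $ j) (at t within s)"
    unfolding eq by (rule has_field_derivative_at_within)
qed

lemma mat_exp_commute:
  fixes M :: "real^'n^'n"
  shows "mat_exp M ** M = M ** mat_exp M"
  using bounded_linear_mat_exp_suminf(1)
    [OF bounded_bilinear.bounded_linear_right [OF bounded_bilinear_matrix_mult], of M M]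
    bounded_linear_mat_exp_suminf(1)
    [OF bounded_bilinear.bounded_linear_left [OF bounded_bilinear_matrix_mult], of M M]
  by (simp add: mat_power_commute)

lemma mat_exp_scaleR_commute:
  fixes M :: "real^'n^'n"
  shows "mat_exp (t *\<^sub>R M) ** M = M ** mat_exp (t *\<^sub>R M)"
proof (cases "t = 0")
  case False
  then show ?thesis
    using mat_exp_commute [of "t *\<^sub>R M"]
    by (simp add: matrix_scalar_ac scalar_matrix_assoc [symmetric])
qed simp

text \<open>The affine argument covers the propagators e^((t-s)A) and e^((\<kappa>-t)A) as well as
  the inverse e^(-tA).\<close>

lemma mat_exp_affine_has_vector_derivative_within:
  fixes M :: "real^'n^'n"
  shows "((\<lambda>t. mat_exp ((a + c * t) *\<^sub>R M)) has_vector_derivative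
    c *\<^sub>R (M ** mat_exp ((a + c * t) *\<^sub>R M))) (at t within s)"
proof -
  have "((\<lambda>t. a + c * t) has_vector_derivative c) (at t within s)"
    by (auto intro!: derivative_eq_intros)
  from vector_diff_chain_within [OF this mat_exp_has_vector_derivative_within]
  show ?thesis by (simp add: o_def)
qed

lemma mat_exp_minus:
  fixes M :: "real^'n^'n"
  shows "mat_exp (- t *\<^sub>R M) ** mat_exp (t *\<^sub>R M) = mat 1"
    and "mat_exp (t *\<^sub>R M) ** mat_exp (- t *\<^sub>R M) = mat 1"
proof -
  have *: "mat_exp (- t *\<^sub>R M) ** mat_exp (t *\<^sub>R M) = mat 1" for t
  proof -
    have "(\<lambda>t. mat_exp (- t *\<^sub>R M) ** mat_exp (t *\<^sub>R M)) t = (\<lambda>t. mat_exp (- t *\<^sub>R M) ** mat_exp (t *\<^sub>R M)) 0"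
    \<comment> \<open>The symmetric interval contains both 0 and \<open>t\<close>, whatever the sign
      of \<open>t\<close>.\<close>
    proof (rule derivative_zero_imp_eq [where a = "-\<bar>t\<bar>" and b = "\<bar>t\<bar>"])
      fix x
      have "((\<lambda>t. mat_exp (- t *\<^sub>R M) ** mat_exp (t *\<^sub>R M)) has_vector_derivative
        mat_exp (- x *\<^sub>R M) ** (M ** mat_exp (x *\<^sub>R M)) +
        (- 1 *\<^sub>R (M ** mat_exp (- x *\<^sub>R M))) ** mat_exp (x *\<^sub>R M)) (at x within {-\<bar>t\<bar>..\<bar>t\<bar>})"
        using mat_exp_affine_has_vector_derivative_within [of 0 "-1" M]
        by (intro has_vector_derivative_matrix_mult mat_exp_has_vector_derivative_within) simp
      then show "((\<lambda>t. mat_exp (- t *\<^sub>R M) ** mat_exp (t *\<^sub>R M)) has_vector_derivative 0)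
          (at x within {-\<bar>t\<bar>..\<bar>t\<bar>})"
        using mat_exp_scaleR_commute [of "-x" M]
        by (simp add: matrix_mul_assoc matrix_mult_uminus_left)
    qed auto
    then show ?thesis by simp
  qed
  from * show "mat_exp (- t *\<^sub>R M) ** mat_exp (t *\<^sub>R M) = mat 1" .
  from *[of "-t"] show "mat_exp (t *\<^sub>R M) ** mat_exp (- t *\<^sub>R M) = mat 1" by simp
qed

section \<open>Continuity and derivative of the matrix inverse\<close>

lemma matrix_inv_left: "invertible A \<Longrightarrow> matrix_inv A ** A = mat 1"
  and matrix_inv_right: "invertible A \<Longrightarrow> A ** matrix_inv A = mat 1"
  unfolding invertible_def matrix_inv_def by (metis (mono_tags, lifting) someI_ex)+

lemma invertible_if_injective:
  fixes A :: "real^'n^'n"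
  assumes "\<And>x. A *v x = 0 \<Longrightarrow> x = 0"
  shows "invertible A"
  using assms by (simp add: invertible_left_inverse matrix_left_invertible_ker)

lemma continuous_on_det:
  fixes F :: "'a::topological_space \<Rightarrow> real^'n^'n"
  assumes "\<And>i j. continuous_on s (\<lambda>t. F t $ i $ j)"
  shows "continuous_on s (\<lambda>t. det (F t))"
  unfolding det_def by (intro continuous_intros assms)

text \<open>By Cramer's rule the entries of the inverse are quotients of determinants, hence of
  polynomials in the entries of \<open>F t\<close>, with a denominator that does not vanish.\<close>

lemma continuous_on_matrix_inv:
  fixes F :: "'a::topological_space \<Rightarrow> real^'n^'n"
  assumes F: "continuous_on s F" and inv: "\<And>t. t \<in> s \<Longrightarrow> invertible (F t)"
  shows "continuous_on s (\<lambda>t. matrix_inv (F t))"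
proof -
  have comp: "matrix_inv (F t) $ k $ l =
      det (\<chi> i j. if j = k then axis l 1 $ i else F t $ i $ j) / det (F t)" if "t \<in> s" for t k l
  proof -
    have "F t *v column l (matrix_inv (F t)) = axis l 1"
      using matrix_inv_right [OF inv [OF that]]
      by (metis column_def matrix_vector_mul_assoc matrix_vector_mult_basis matrix_vector_mul_lid)
    then have "column l (matrix_inv (F t)) =
        (\<chi> k. det (\<chi> i j. if j = k then axis l 1 $ i else F t $ i $ j) / det (F t))"
      using cramer inv [OF that] invertible_det_nz by blast
    then show ?thesis
      by (metis (no_types, lifting) column_def vec_lambda_beta)
  qed
  have F': "continuous_on s (\<lambda>t. F t $ i $ j)" for i j
    by (intro continuous_on_component F)
  have "continuous_on s (\<lambda>t. det (\<chi> i j. if j = k then axis l 1 $ i else F t $ i $ j) / det (F t))"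
    for k l
  proof (intro continuous_on_divide continuous_on_det)
    show "continuous_on s (\<lambda>t. (\<chi> i j. if j = k then axis l 1 $ i else F t $ i $ j) $ a $ b)" for a b
      by (cases "b = k") (simp_all add: F')
  qed (use F' inv in \<open>simp_all flip: invertible_det_nz\<close>)
  then have "continuous_on s (\<lambda>t. \<chi> k l. det (\<chi> i j. if j = k then axis l 1 $ i else F t $ i $ j) / det (F t))"
    by (intro continuous_on_vec_lambda)
  then show ?thesis
    by (rule continuous_on_eq) (simp add: vec_eq_iff comp)
qed

lemma has_vector_derivative_iff_quotient:
  fixes F :: "real \<Rightarrow> 'a::real_normed_vector"
  shows "(F has_vector_derivative F') (at t within s) \<longleftrightarrow>
    ((\<lambda>r. (1 / (r - t)) *\<^sub>R (F r - F t)) \<longlongrightarrow> F') (at t within s)"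
proof -
  have "norm ((F r - F t) - (r - t) *\<^sub>R F') / norm (r - t) =
      norm ((1 / (r - t)) *\<^sub>R (F r - F t) - F')" if "r \<noteq> t" for r
  proof -
    have "(1 / (r - t)) *\<^sub>R (F r - F t) - F' = (1 / (r - t)) *\<^sub>R ((F r - F t) - (r - t) *\<^sub>R F')"
      using that by (simp add: scaleR_diff_right)
    then show ?thesis by simp
  qed
  then have "((\<lambda>r. norm ((F r - F t) - (r - t) *\<^sub>R F') / norm (r - t)) \<longlongrightarrow> 0) (at t within s) \<longleftrightarrow>
    ((\<lambda>r. norm ((1 / (r - t)) *\<^sub>R (F r - F t) - F')) \<longlongrightarrow> 0) (at t within s)"
    by (intro tendsto_cong) (auto simp: eventually_at_filter)
  then show ?thesis
    unfolding has_vector_derivative_def has_derivative_iff_norm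
    by (simp add: bounded_linear_scaleR_left tendsto_norm_zero_iff flip: Lim_null)
qed

text \<open>For U = F^(-1) one has U(r) - U(t) = -U(r) (F(r) - F(t)) U(t); divide by r - t and use
  the continuity of U.\<close>

lemma has_vector_derivative_matrix_inv:
  fixes F :: "real \<Rightarrow> real^'n^'n"
  assumes F: "\<And>t. t \<in> s \<Longrightarrow> (F has_vector_derivative F' t) (at t within s)"
    and inv: "\<And>t. t \<in> s \<Longrightarrow> invertible (F t)" and t: "t \<in> s"
  shows "((\<lambda>t. matrix_inv (F t)) has_vector_derivative
    - (matrix_inv (F t) ** F' t ** matrix_inv (F t))) (at t within s)"
proof -
  let ?U = "\<lambda>t. matrix_inv (F t)"
  interpret bounded_bilinear "(**) :: real^'n^'n \<Rightarrow> real^'n^'n \<Rightarrow> real^'n^'n"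
    by (rule bounded_bilinear_matrix_mult)
  have "continuous_on s F"
    using F by (auto simp: continuous_on_eq_continuous_within intro: has_vector_derivative_continuous)
  then have "continuous_on s ?U" by (intro continuous_on_matrix_inv inv)
  then have U: "(?U \<longlongrightarrow> ?U t) (at t within s)"
    using t by (simp add: continuous_on_def)
  have "((\<lambda>r. (1 / (r - t)) *\<^sub>R (F r - F t)) \<longlongrightarrow> F' t) (at t within s)"
    using F [OF t] by (simp add: has_vector_derivative_iff_quotient)
  then have lim: "((\<lambda>r. - (?U r ** ((1 / (r - t)) *\<^sub>R (F r - F t)) ** ?U t)) \<longlongrightarrow>
      - (?U t ** F' t ** ?U t)) (at t within s)"
    by (intro tendsto_minus tendsto U tendsto_const)
  have eq: "- (?U r ** ((1 / (r - t)) *\<^sub>R (F r - F t)) ** ?U t) = (1 / (r - t)) *\<^sub>R (?U r - ?U t)"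
    if "r \<in> s" for r
    using matrix_inv_left [OF inv [OF that]] matrix_inv_right [OF inv [OF t]]
    by (simp add: diff_left diff_right scaleR_left scaleR_right scaleR_diff_right
        matrix_mul_assoc [symmetric])
  have "((\<lambda>r. (1 / (r - t)) *\<^sub>R (?U r - ?U t)) \<longlongrightarrow> - (?U t ** F' t ** ?U t)) (at t within s)"
    by (rule Lim_transform_eventually [OF lim]) (simp add: eventually_at_filter eq)
  then show ?thesis
    by (simp add: has_vector_derivative_iff_quotient)
qed

section \<open>Hamiltonian systems and the Riccati equation\<close>

lemmas matrix_ring_simps =
  matrix_add_ldistrib matrix_add_rdistrib matrix_mult_uminus_left matrix_mult_uminus_right
  bounded_bilinear.diff_left [OF bounded_bilinear_matrix_mult]
  bounded_bilinear.diff_right [OF bounded_bilinear_matrix_mult]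
  matrix_mul_assoc

text \<open>Move from \<open>x\<close> in the direction z = M x: the form becomes 2 s a + s^2 c,
  which is negative at s = -a / (1 + c) unless a = |M x|^2 is 0. The 1 in the denominator covers the
  case c = 0.\<close>

lemma psd_mat_zero:
  assumes M: "psd_mat M" and x: "x \<bullet> (M *v x) = 0"
  shows "M *v x = 0"
proof -
  define z where "z = M *v x"
  define a where "a = z \<bullet> z"
  define c where "c = z \<bullet> (M *v z)"
  define s where "s = - a / (1 + c)"
  have sym: "symmetric_mat M" and psd: "\<And>x. 0 \<le> x \<bullet> (M *v x)"
    using M by (auto simp: psd_mat_def)
  have c: "c \<ge> 0" unfolding c_def by (rule psd)
  have xz: "x \<bullet> (M *v z) = a" "z \<bullet> (M *v x) = a"
    using symmetric_mat_inner [OF sym] by (simp_all add: a_def z_def)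
  have "0 \<le> (x + s *\<^sub>R z) \<bullet> (M *v (x + s *\<^sub>R z))" by (rule psd)
  also have "\<dots> = 2 * s * a + s * s * c"
    by (simp add: matrix_vector_right_distrib matrix_vector_mult_scaleR inner_add_left
        inner_add_right x xz c_def [symmetric] algebra_simps)
  also have "\<dots> = - (a * a * (2 + c)) / (1 + c)\<^sup>2"
    using c by (simp add: s_def divide_simps) (simp add: algebra_simps power2_eq_square)
  finally have "0 \<le> - (a * a * (2 + c)) / (1 + c)\<^sup>2" .
  moreover have "0 < (1 + c)\<^sup>2" using c by simp
  ultimately have "a * a * (2 + c) \<le> 0"
    by (simp add: divide_le_0_iff)
  then have "a = 0"
    using c by (smt (verit) mult_pos_pos not_real_square_gt_zero)
  then show ?thesis by (simp add: a_def z_def)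
qed

text \<open>The equality case of monotonicity: a function that can only decrease but ends no lower
  than it began is constant. It turns a zero total cost into a zero cost at every time.\<close>

lemma derivative_nonpos_const:
  fixes f :: "real \<Rightarrow> real"
  assumes f: "\<And>t. t \<in> {a..b} \<Longrightarrow> (f has_real_derivative f' t) (at t within {a..b})"
    and le: "\<And>t. t \<in> {a..b} \<Longrightarrow> f' t \<le> 0" and "a < b" and ba: "f a \<le> f b" and t: "t \<in> {a..b}"
  shows "f' t = 0"
proof -
  have mono: "f s \<le> f r" if "r \<in> {a..b}" "s \<in> {a..b}" "r \<le> s" for r s
  proof (rule derivative_nonpos_imp_le [OF _ _ that(3)])
    show "(f has_real_derivative f' x) (at x within {r..s})" if "x \<in> {r..s}" for x
      using that \<open>r \<in> {a..b}\<close> \<open>s \<in> {a..b}\<close> by (intro DERIV_subset [OF f]) auto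
  qed (use le that in auto)
  have const: "f s = f a" if "s \<in> {a..b}" for s
    using mono [of a s] mono [of s b] that ba by auto
  have 0: "(f has_vector_derivative 0) (at t within {a..b})"
    by (rule has_vector_derivative_transform [OF t const has_vector_derivative_const])
  have 1: "(f has_vector_derivative f' t) (at t within {a..b})"
    using f [OF t] by (simp add: has_real_derivative_iff_has_vector_derivative)
  show ?thesis
    using vector_derivative_unique_within_closed_interval [of a b t f "f' t" 0] 0 1 \<open>a < b\<close> t by simp
qed

section \<open>The Hamiltonian flow in block form and its link with the Riccati equation\<close>

definition ham_sol ::
  "real \<Rightarrow> real^'n^'n \<Rightarrow> real^'n^'n \<Rightarrow> real^'n^'n \<Rightarrow> (real \<Rightarrow> real^'n^'n) \<Rightarrow> (real \<Rightarrow> real^'n^'n) \<Rightarrow> bool"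
  where "ham_sol \<kappa> At Rt Qt X Y \<longleftrightarrow> (\<forall>t\<in>{0..\<kappa>}.
    (X has_vector_derivative (At ** X t - Rt ** Y t)) (at t within {0..\<kappa>}) \<and>
    (Y has_vector_derivative (- (Qt ** X t) - transpose At ** Y t)) (at t within {0..\<kappa>}))"

lemma block_mat_nth [simp]:
  "block_mat M11 M12 M21 M22 $ Inl i $ Inl j = M11 $ i $ j"
  "block_mat M11 M12 M21 M22 $ Inl i $ Inr j = M12 $ i $ j"
  "block_mat M11 M12 M21 M22 $ Inr i $ Inl j = M21 $ i $ j"
  "block_mat M11 M12 M21 M22 $ Inr i $ Inr j = M22 $ i $ j"
  by (simp_all add: block_mat_def)

lemma block_mat_eq_iff:
  "M = block_mat M11 M12 M21 M22 \<longleftrightarrow>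
    (\<forall>i j. M $ Inl i $ Inl j = M11 $ i $ j \<and> M $ Inl i $ Inr j = M12 $ i $ j \<and>
      M $ Inr i $ Inl j = M21 $ i $ j \<and> M $ Inr i $ Inr j = M22 $ i $ j)"
  by (auto simp: vec_eq_iff split_sum_all)

lemma block_mat_inject:
  "block_mat M11 M12 M21 M22 = block_mat N11 N12 N21 N22 \<longleftrightarrow>
    M11 = N11 \<and> M12 = N12 \<and> M21 = N21 \<and> M22 = N22"
  unfolding block_mat_eq_iff by (auto simp: vec_eq_iff)

lemma block_mat_cases:
  fixes M :: "'a^('n::finite + 'n)^('n + 'n)"
  obtains M11 M12 M21 M22 where "M = block_mat M11 M12 M21 M22"
proof
  show "M = block_mat (\<chi> i j. M $ Inl i $ Inl j) (\<chi> i j. M $ Inl i $ Inr j)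
      (\<chi> i j. M $ Inr i $ Inl j) (\<chi> i j. M $ Inr i $ Inr j)"
    by (simp add: block_mat_eq_iff)
qed

lemma sum_UNIV_sum_type:
  fixes f :: "'a::finite + 'b::finite \<Rightarrow> 'c::comm_monoid_add"
  shows "sum f UNIV = (\<Sum>i\<in>UNIV. f (Inl i)) + (\<Sum>j\<in>UNIV. f (Inr j))"
  by (simp add: sum.Plus flip: UNIV_Plus_UNIV)

lemma block_mat_mult:
  fixes M11 :: "'a::semiring_1^'n^'n"
  shows "block_mat M11 M12 M21 M22 ** block_mat N11 N12 N21 N22 =
    block_mat (M11 ** N11 + M12 ** N21) (M11 ** N12 + M12 ** N22)
      (M21 ** N11 + M22 ** N21) (M21 ** N12 + M22 ** N22)"
  unfolding block_mat_eq_iff by (simp add: matrix_matrix_mult_def sum_UNIV_sum_type)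

lemma block_mat_one: "mat 1 = block_mat (mat 1) 0 0 (mat 1 :: 'a::semiring_1^'n^'n)"
  unfolding block_mat_eq_iff by (simp add: mat_def)

lemma has_vector_derivative_block_mat:
  fixes M11 :: "real \<Rightarrow> real^'n^'n"
  shows "((\<lambda>t. block_mat (M11 t) (M12 t) (M21 t) (M22 t)) has_vector_derivative block_mat D11 D12 D21 D22)
      (at t within s) \<longleftrightarrow>
    (M11 has_vector_derivative D11) (at t within s) \<and> (M12 has_vector_derivative D12) (at t within s) \<and>
    (M21 has_vector_derivative D21) (at t within s) \<and> (M22 has_vector_derivative D22) (at t within s)"
  unfolding has_vector_derivative_matrix_componentwise by (auto simp: split_sum_all)

lemma ham_sol_flow:
  fixes At Rt Qt :: "real^'n^'n"
  assumes "block_mat P11 P12 P21 P22 = mat_exp (\<kappa> *\<^sub>R block_mat At (- Rt) (- Qt) (- transpose At))"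
  obtains X Y where "ham_sol \<kappa> At Rt Qt X Y" "X 0 = X0" "Y 0 = Y0"
    "X \<kappa> = P11 ** X0 + P12 ** Y0" "Y \<kappa> = P21 ** X0 + P22 ** Y0"
proof -
  let ?Z = "block_mat At (- Rt) (- Qt) (- transpose At)"
  have "\<exists>p11 p12 p21 p22. mat_exp (t *\<^sub>R ?Z) = block_mat p11 p12 p21 p22" for t
    using block_mat_cases by metis
  then obtain p11 p12 p21 p22 where
    p: "\<And>t. mat_exp (t *\<^sub>R ?Z) = block_mat (p11 t) (p12 t) (p21 t) (p22 t)"
    by metis
  have p0: "p11 0 = mat 1" "p12 0 = 0" "p21 0 = 0" "p22 0 = mat 1"
    using p [of 0] block_mat_one block_mat_inject by (metis mat_exp_zero scale_zero_left)+
  have p\<kappa>: "p11 \<kappa> = P11" "p12 \<kappa> = P12" "p21 \<kappa> = P21" "p22 \<kappa> = P22"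
    using p [of \<kappa>] assms by (simp_all add: block_mat_inject)
  have d: "(p11 has_vector_derivative (At ** p11 t - Rt ** p21 t)) (at t within {0..\<kappa>})"
    "(p12 has_vector_derivative (At ** p12 t - Rt ** p22 t)) (at t within {0..\<kappa>})"
    "(p21 has_vector_derivative (- (Qt ** p11 t) - transpose At ** p21 t)) (at t within {0..\<kappa>})"
    "(p22 has_vector_derivative (- (Qt ** p12 t) - transpose At ** p22 t)) (at t within {0..\<kappa>})" for t
    using mat_exp_has_vector_derivative_within [of ?Z t "{0..\<kappa>}"]
    unfolding p block_mat_mult has_vector_derivative_block_mat by (simp_all add: matrix_ring_simps)
  show thesis
  proof
    show "ham_sol \<kappa> At Rt Qt (\<lambda>t. p11 t ** X0 + p12 t ** Y0) (\<lambda>t. p21 t ** X0 + p22 t ** Y0)"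
      unfolding ham_sol_def
      by (auto intro!: derivative_eq_intros has_vector_derivative_matrix_mult d simp: matrix_ring_simps)
  qed (simp_all add: p0 p\<kappa>)
qed

lemma ham_flow_inverse:
  fixes At Rt Qt :: "real^'n^'n"
  assumes "block_mat P11 P12 P21 P22 = mat_exp (\<kappa> *\<^sub>R block_mat At (- Rt) (- Qt) (- transpose At))"
  obtains N11 N12 N21 N22 where
    "block_mat P11 P12 P21 P22 ** block_mat N11 N12 N21 N22 = mat 1"
    "block_mat N11 N12 N21 N22 ** block_mat P11 P12 P21 P22 = mat 1"
  using block_mat_cases [of "mat_exp (- \<kappa> *\<^sub>R block_mat At (- Rt) (- Qt) (- transpose At))"]
    mat_exp_minus assms by metis

text \<open>The defect \<open>Y t - S t ** X t\<close> solves the homogeneous linear equation with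
  coefficient \<open>- transpose At + S t ** Rt\<close> and starts at zero. No inverse of
  \<open>X t\<close> enters.\<close>

lemma ham_sol_riccati:
  assumes S: "riccati_ode \<kappa> At Rt Qt S" and h: "ham_sol \<kappa> At Rt Qt X Y"
    and 0: "Y 0 = S 0 ** X 0" and t: "t \<in> {0..\<kappa>}"
  shows "Y t = S t ** X t"
proof -
  have S': "(S has_vector_derivative
        (- (transpose At ** S t) - S t ** At + S t ** Rt ** S t - Qt)) (at t within {0..\<kappa>})"
    if "t \<in> {0..\<kappa>}" for t
    using S that by (auto simp: riccati_ode_def)
  have X: "(X has_vector_derivative (At ** X t - Rt ** Y t)) (at t within {0..\<kappa>})"
    and Y: "(Y has_vector_derivative (- (Qt ** X t) - transpose At ** Y t)) (at t within {0..\<kappa>})"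
    if "t \<in> {0..\<kappa>}" for t
    using h that by (auto simp: ham_sol_def)
  have "Y t - S t ** X t = 0"
  proof (rule matrix_ode_unique [where V = "\<lambda>t. Y t - S t ** X t" and M = "\<lambda>t. - transpose At + S t ** Rt"
        and W = "\<lambda>_. 0" and s = 0, OF _ _ _ _ _ t])
    show "((\<lambda>t. Y t - S t ** X t) has_vector_derivative
        (- transpose At + S t ** Rt) ** (Y t - S t ** X t)) (at t within {0..\<kappa>})"
      if "t \<in> {0..\<kappa>}" for t
      by (rule has_vector_derivative_eq_rhs [OF has_vector_derivative_diff
            [OF Y [OF that] has_vector_derivative_matrix_mult [OF S' [OF that] X [OF that]]]])
        (simp add: matrix_ring_simps algebra_simps)
    have "continuous_on {0..\<kappa>} S"
      using S' by (rule continuous_on_vector_derivative)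
    then show "continuous_on {0..\<kappa>} (\<lambda>t. - transpose At + S t ** Rt)"
      by (intro continuous_intros continuous_on_matrix_mult)
  qed (use 0 t in auto)
  then show ?thesis by simp
qed

lemma riccati_ode_of_ham_sol:
  assumes h: "ham_sol \<kappa> At Rt Qt X Y" and inv: "\<And>t. t \<in> {0..\<kappa>} \<Longrightarrow> invertible (X t)"
  shows "riccati_ode \<kappa> At Rt Qt (\<lambda>t. Y t ** matrix_inv (X t))"
  unfolding riccati_ode_def
proof
  fix t assume t: "t \<in> {0..\<kappa>}"
  let ?U = "\<lambda>t. matrix_inv (X t)"
  have X: "(X has_vector_derivative (At ** X t - Rt ** Y t)) (at t within {0..\<kappa>})"
    and Y: "(Y has_vector_derivative (- (Qt ** X t) - transpose At ** Y t)) (at t within {0..\<kappa>})"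
    if "t \<in> {0..\<kappa>}" for t
    using h that by (auto simp: ham_sol_def)
  have XU: "M ** X t ** ?U t = M" for M :: "real^'a^'a"
    using matrix_inv_right [OF inv [OF t]] by (simp flip: matrix_mul_assoc)
  have "((\<lambda>t. Y t ** ?U t) has_vector_derivative
      Y t ** - (?U t ** (At ** X t - Rt ** Y t) ** ?U t) +
      (- (Qt ** X t) - transpose At ** Y t) ** ?U t) (at t within {0..\<kappa>})"
    by (intro has_vector_derivative_matrix_mult has_vector_derivative_matrix_inv X Y inv t)
  then show "((\<lambda>t. Y t ** ?U t) has_vector_derivative
      - (transpose At ** (Y t ** ?U t)) - Y t ** ?U t ** At + Y t ** ?U t ** Rt ** (Y t ** ?U t) - Qt)
      (at t within {0..\<kappa>})"
    by (rule has_vector_derivative_eq_rhs) (simp add: matrix_ring_simps XU algebra_simps)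
qed

text \<open>Along a Riccati solution X' = (At - Rt S) X, so each X v solves a homogeneous linear
  equation and vanishes everywhere once it vanishes somewhere.\<close>

lemma ham_sol_riccati_kernel:
  assumes S: "riccati_ode \<kappa> At Rt Qt S" and h: "ham_sol \<kappa> At Rt Qt X Y"
    and 0: "Y 0 = S 0 ** X 0" and t: "t \<in> {0..\<kappa>}" and v: "X t *v v = 0"
  shows "X 0 *v v = 0"
proof (rule vector_ode_unique [where V = "\<lambda>t. X t *v v" and W = "\<lambda>_. 0" and s = t
      and M = "\<lambda>t. At - Rt ** S t"])
  show "((\<lambda>t. X t *v v) has_vector_derivative (At - Rt ** S r) *v (X r *v v)) (at r within {0..\<kappa>})"
    if "r \<in> {0..\<kappa>}" for r
  proof -
    have "(X has_vector_derivative (At ** X r - Rt ** Y r)) (at r within {0..\<kappa>})"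
      using h that by (auto simp: ham_sol_def)
    from has_vector_derivative_matrix_vector_mult [OF this has_vector_derivative_const]
    show ?thesis
      using ham_sol_riccati [OF S h 0 that] by (simp add: matrix_ring_simps matrix_vector_mul_assoc)
  qed
  have "continuous_on {0..\<kappa>} S"
    using S unfolding riccati_ode_def by (intro continuous_on_vector_derivative) auto
  then show "continuous_on {0..\<kappa>} (\<lambda>t. At - Rt ** S t)"
    by (intro continuous_intros continuous_on_matrix_mult)
qed (use t v in auto)

lemma ham_sol_riccati_invertible:
  assumes "riccati_ode \<kappa> At Rt Qt S" "ham_sol \<kappa> At Rt Qt X Y" "X 0 = mat 1" "Y 0 = S 0"
    and "t \<in> {0..\<kappa>}"
  shows "invertible (X t)"
  using ham_sol_riccati_kernel [OF assms(1,2)] assms(3-5) by (intro invertible_if_injective) auto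

lemma invertible_mult_right_cancel:
  fixes M :: "real^'n^'n"
  assumes "invertible M" "A ** M = B ** M"
  shows "A = B"
  using assms by (metis matrix_inv_right matrix_mul_assoc matrix_mul_rid)

text \<open>The equation is nonlinear, so uniqueness is borrowed from the linear system:
  \<open>S t\<close> and \<open>S' t\<close> both carry the same \<open>X t\<close> to the same
  \<open>Y t\<close>, and \<open>X t\<close> is invertible.\<close>

lemma riccati_ode_unique:
  assumes S: "riccati_ode \<kappa> At Rt Qt S" and S': "riccati_ode \<kappa> At Rt Qt S'"
    and 0: "S 0 = S' 0" and t: "t \<in> {0..\<kappa>}"
  shows "S t = S' t"
proof -
  obtain P11 P12 P21 P22 where
    "mat_exp (\<kappa> *\<^sub>R block_mat At (- Rt) (- Qt) (- transpose At)) = block_mat P11 P12 P21 P22"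
    by (rule block_mat_cases)
  note P = this [symmetric]
  obtain X Y where
    h: "ham_sol \<kappa> At Rt Qt X Y" "X 0 = mat 1" "Y 0 = S 0" by (rule ham_sol_flow [OF P])
  have "S t ** X t = S' t ** X t"
    using ham_sol_riccati [OF S h(1) _ t] ham_sol_riccati [OF S' h(1) _ t] h 0 by simp
  with ham_sol_riccati_invertible [OF S h t] show ?thesis
    by (rule invertible_mult_right_cancel)
qed

text \<open>The flow ends at the pair (P11 + P12 S0, P21 + P22 S0), and Y = S X there. The algebraic
  equation is thus the terminal condition multiplied on the right by the invertible
  \<open>X \<kappa>\<close>.\<close>

lemma riccati_ode_terminal_iff:
  assumes P: "block_mat P11 P12 P21 P22 = mat_exp (\<kappa> *\<^sub>R block_mat At (- Rt) (- Qt) (- transpose At))"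
    and S: "riccati_ode \<kappa> At Rt Qt S" and "\<kappa> > 0"
  shows "S \<kappa> = transpose C ** S 0 ** C \<longleftrightarrow> algebraic_periodic_riccati C P11 P12 P21 P22 (S 0)"
proof -
  obtain X Y where
    h: "ham_sol \<kappa> At Rt Qt X Y" "X 0 = mat 1" "Y 0 = S 0"
    and "X \<kappa> = P11 ** mat 1 + P12 ** S 0" "Y \<kappa> = P21 ** mat 1 + P22 ** S 0"
    by (rule ham_sol_flow [OF P])
  then have \<kappa>: "X \<kappa> = P11 + P12 ** S 0" "Y \<kappa> = P21 + P22 ** S 0"
    by simp_all
  have inv: "invertible (X \<kappa>)"
    using \<open>\<kappa> > 0\<close> by (intro ham_sol_riccati_invertible [OF S h]) auto
  have Y: "Y \<kappa> = S \<kappa> ** X \<kappa>"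
    using ham_sol_riccati [OF S h(1)] h \<open>\<kappa> > 0\<close> by simp
  show ?thesis
    unfolding algebraic_periodic_riccati_def \<kappa> [symmetric] Y
    using invertible_mult_right_cancel [OF inv] by metis
qed

section \<open>The pairing of X and Y: dissipation, symplectic invariance and negative index\<close>

lemma ham_pairing:
  assumes h: "ham_sol \<kappa> At Rt Qt X Y" and Rt: "symmetric_mat Rt" and t: "t \<in> {0..\<kappa>}"
  shows "((\<lambda>t. (X t *v v) \<bullet> (Y t *v w)) has_real_derivative
    - ((Y t *v v) \<bullet> (Rt *v (Y t *v w))) - (X t *v v) \<bullet> (Qt *v (X t *v w))) (at t within {0..\<kappa>})"
proof -
  have X: "(X has_vector_derivative (At ** X t - Rt ** Y t)) (at t within {0..\<kappa>})"
    and Y: "(Y has_vector_derivative (- (Qt ** X t) - transpose At ** Y t)) (at t within {0..\<kappa>})"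
    using h t by (auto simp: ham_sol_def)
  have "((\<lambda>t. X t *v v) has_vector_derivative At *v (X t *v v) - Rt *v (Y t *v v)) (at t within {0..\<kappa>})"
    using has_vector_derivative_matrix_vector_mult [OF X has_vector_derivative_const]
    by (simp add: matrix_vector_mult_diff_rdistrib matrix_vector_mul_assoc)
  moreover have "((\<lambda>t. Y t *v w) has_vector_derivative
      - (Qt *v (X t *v w)) - transpose At *v (Y t *v w)) (at t within {0..\<kappa>})"
    using has_vector_derivative_matrix_vector_mult [OF Y has_vector_derivative_const]
    by (simp add: matrix_vector_mult_diff_rdistrib matrix_vector_mult_uminus_left
        matrix_vector_mul_assoc del: transpose_matrix_vector)
  ultimately have "((\<lambda>t. (X t *v v) \<bullet> (Y t *v w)) has_real_derivative
     (At *v (X t *v v) - Rt *v (Y t *v v)) \<bullet> (Y t *v w) +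
     (X t *v v) \<bullet> (- (Qt *v (X t *v w)) - transpose At *v (Y t *v w))) (at t within {0..\<kappa>})"
    by (rule has_vector_derivative_inner)
  \<comment> \<open>The \<open>At\<close> terms of the two factors cancel; what remains is minus the
    control cost and minus the state cost, polarised in \<open>v\<close> and
    \<open>w\<close>.\<close>
  then show ?thesis
    using symmetric_mat_inner [OF Rt, of "Y t *v v" "Y t *v w"]
      inner_matrix_vector_transpose [of "X t *v v" "transpose At" "Y t *v w"]
    by (simp add: inner_diff_left inner_diff_right del: transpose_matrix_vector)
qed

text \<open>The derivative found in \<open>ham_pairing\<close> is symmetric in \<open>v\<close> and
  \<open>w\<close>, so the antisymmetric part of the pairing is conserved: the flow preserves the
  symplectic form.\<close>

lemma ham_symplectic:
  assumes h: "ham_sol \<kappa> At Rt Qt X Y" and Rt: "symmetric_mat Rt" and Qt: "symmetric_mat Qt"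
    and st: "s \<in> {0..\<kappa>}" "t \<in> {0..\<kappa>}"
  shows "(X s *v v) \<bullet> (Y s *v w) - (X s *v w) \<bullet> (Y s *v v) =
    (X t *v v) \<bullet> (Y t *v w) - (X t *v w) \<bullet> (Y t *v v)"
proof (rule derivative_zero_imp_eq [OF _ st])
  fix r assume r: "r \<in> {0..\<kappa>}"
  show "((\<lambda>t. (X t *v v) \<bullet> (Y t *v w) - (X t *v w) \<bullet> (Y t *v v)) has_vector_derivative 0)
      (at r within {0..\<kappa>})"
    using DERIV_diff [OF ham_pairing [OF h Rt r, of v w] ham_pairing [OF h Rt r, of w v]]
      symmetric_mat_inner [OF Rt, of "Y r *v v" "Y r *v w"]
      symmetric_mat_inner [OF Qt, of "X r *v v" "X r *v w"]
    by (simp add: has_real_derivative_iff_has_vector_derivative inner_commute)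
qed

lemma ham_pairing_decreasing:
  assumes h: "ham_sol \<kappa> At Rt Qt X Y" and Rt: "psd_mat Rt" and Qt: "psd_mat Qt"
    and "0 \<le> s" "s \<le> t" "t \<le> \<kappa>"
  shows "(X t *v v) \<bullet> (Y t *v v) \<le> (X s *v v) \<bullet> (Y s *v v)"
proof (rule derivative_nonpos_imp_le [OF _ _ \<open>s \<le> t\<close>])
  fix r assume r: "r \<in> {s..t}"
  then have "r \<in> {0..\<kappa>}" using assms by auto
  then show "((\<lambda>t. (X t *v v) \<bullet> (Y t *v v)) has_real_derivative
      - ((Y r *v v) \<bullet> (Rt *v (Y r *v v))) - (X r *v v) \<bullet> (Qt *v (X r *v v))) (at r within {s..t})"
    using assms by (intro DERIV_subset [OF ham_pairing [OF h]]) (auto simp: psd_mat_def)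
  have "0 \<le> (Y r *v v) \<bullet> (Rt *v (Y r *v v))" "0 \<le> (X r *v v) \<bullet> (Qt *v (X r *v v))"
    using Rt Qt by (auto simp: psd_mat_def)
  then show "- ((Y r *v v) \<bullet> (Rt *v (Y r *v v))) - (X r *v v) \<bullet> (Qt *v (X r *v v)) \<le> 0"
    by linarith
qed

text \<open>If the pairing does not strictly decrease, the trajectory costs nothing, hence is a
  solution of the uncontrolled equation, which cannot leave the origin.\<close>

lemma ham_degenerate:
  assumes h: "ham_sol \<kappa> At Rt Qt X Y" and Rt: "psd_mat Rt" and Qt: "psd_mat Qt"
    and s: "s \<in> {0..\<kappa>}" "X s *v v = 0" and \<kappa>: "0 \<le> (X \<kappa> *v v) \<bullet> (Y \<kappa> *v v)"
  shows "X \<kappa> *v v = 0"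
proof (cases "s = \<kappa>")
  case False
  with s have "s < \<kappa>" by auto
  let ?f' = "\<lambda>r. - ((Y r *v v) \<bullet> (Rt *v (Y r *v v))) - (X r *v v) \<bullet> (Qt *v (X r *v v))"
  have nonneg: "0 \<le> (Y r *v v) \<bullet> (Rt *v (Y r *v v))" "0 \<le> (X r *v v) \<bullet> (Qt *v (X r *v v))" for r
    using Rt Qt by (auto simp: psd_mat_def)
  have "?f' r = 0" if r: "r \<in> {s..\<kappa>}" for r
  proof (rule derivative_nonpos_const [OF _ _ \<open>s < \<kappa>\<close> _ r])
    show "((\<lambda>t. (X t *v v) \<bullet> (Y t *v v)) has_real_derivative ?f' r) (at r within {s..\<kappa>})"
      if "r \<in> {s..\<kappa>}" for r
      using that s Rt by (intro DERIV_subset [OF ham_pairing [OF h]]) (auto simp: psd_mat_def)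
    show "?f' r \<le> 0" for r
      using nonneg [of r] by linarith
  qed (use s \<kappa> in simp)
  then have Y0: "(Y r *v v) \<bullet> (Rt *v (Y r *v v)) = 0" if "r \<in> {s..\<kappa>}" for r
    using nonneg [of r] that by fastforce
  show ?thesis
  proof (rule vector_ode_unique [where V = "\<lambda>t. X t *v v" and W = "\<lambda>_. 0" and M = "\<lambda>_. At"
        and a = s and b = \<kappa>])
    fix r assume r: "r \<in> {s..\<kappa>}"
    have "(X has_vector_derivative (At ** X r - Rt ** Y r)) (at r within {0..\<kappa>})"
      using h r s by (auto simp: ham_sol_def)
    then have "(X has_vector_derivative (At ** X r - Rt ** Y r)) (at r within {s..\<kappa>})"
      by (rule has_vector_derivative_within_subset) (use s in auto)
    from has_vector_derivative_matrix_vector_mult [OF this has_vector_derivative_const [of v]]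
    show "((\<lambda>t. X t *v v) has_vector_derivative At *v (X r *v v)) (at r within {s..\<kappa>})"
      using psd_mat_zero [OF Rt Y0 [OF r]]
      by (simp add: matrix_vector_mult_diff_rdistrib matrix_vector_mul_assoc)
  qed (use s in auto)
qed (use s in auto)

text \<open>The first block row of the inverse flow recovers the initial block, the identity, from
  the terminal pair.\<close>

lemma ham_flow_injective:
  fixes At Rt Qt :: "real^'n^'n"
  assumes P: "block_mat P11 P12 P21 P22 = mat_exp (\<kappa> *\<^sub>R block_mat At (- Rt) (- Qt) (- transpose At))"
    and 0: "(P11 + P12 ** S0) *v v = 0" "(P21 + P22 ** S0) *v v = 0"
  shows "v = 0"
proof -
  obtain N11 N12 N21 N22 where "block_mat N11 N12 N21 N22 ** block_mat P11 P12 P21 P22 = mat 1"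
    using ham_flow_inverse [OF P] by blast
  then have N: "N11 ** P11 + N12 ** P21 = mat 1" "N11 ** P12 + N12 ** P22 = 0"
    by (simp_all add: block_mat_mult block_mat_one block_mat_inject)
  have "N11 ** (P11 + P12 ** S0) + N12 ** (P21 + P22 ** S0)
      = (N11 ** P11 + N12 ** P21) + (N11 ** P12 + N12 ** P22) ** S0"
    by (simp add: matrix_ring_simps)
  also have "\<dots> = mat 1" by (simp add: N)
  finally have "v = (N11 ** (P11 + P12 ** S0) + N12 ** (P21 + P22 ** S0)) *v v" by simp
  also have "\<dots> = N11 *v ((P11 + P12 ** S0) *v v) + N12 *v ((P21 + P22 ** S0) *v v)"
    by (metis matrix_vector_mult_add_rdistrib matrix_vector_mul_assoc)
  also have "\<dots> = 0" by (simp only: 0 matrix_vector_mult_0_right add_0)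
  finally show ?thesis .
qed

text \<open>For positive semidefinite \<open>S0\<close>, \<open>ham_degenerate\<close> and the
  injectivity of \<open>X \<kappa>\<close> would settle the claim. For indefinite \<open>S0\<close>
  negative directions are counted: with \<open>V\<close> a negative definite subspace of maximal
  dimension, a nonzero \<open>v\<close> killed by \<open>X t\<close> enlarges \<open>V\<close>, and
  \<open>C ** X \<kappa>\<close> carries the enlarged space injectively onto a negative definite
  one.\<close>

lemma ham_sol_invertible:
  fixes At Rt Qt :: "real^'n^'n"
  assumes P: "block_mat P11 P12 P21 P22 = mat_exp (\<kappa> *\<^sub>R block_mat At (- Rt) (- Qt) (- transpose At))"
    and Rt: "psd_mat Rt" and Qt: "psd_mat Qt" and S0: "symmetric_mat S0"
    and alg: "algebraic_periodic_riccati C P11 P12 P21 P22 S0"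
    and h: "ham_sol \<kappa> At Rt Qt X Y" and X0: "X 0 = mat 1" and Y0: "Y 0 = S0"
    and X\<kappa>: "X \<kappa> = P11 + P12 ** S0" and Y\<kappa>: "Y \<kappa> = P21 + P22 ** S0"
    and t: "t \<in> {0..\<kappa>}"
  shows "invertible (X t)"
proof (rule invertible_if_injective)
  fix v assume v: "X t *v v = 0"
  have alg': "Y \<kappa> *v u = transpose C *v (S0 *v (C *v (X \<kappa> *v u)))" for u
    using alg unfolding algebraic_periodic_riccati_def X\<kappa> [symmetric] Y\<kappa> [symmetric]
    by (simp add: matrix_vector_mul_assoc matrix_mul_assoc del: transpose_matrix_vector)
  have inj: "u = 0" if "X \<kappa> *v u = 0" for u
    using ham_flow_injective [OF P, of S0 u] alg' [of u] that
    by (simp add: X\<kappa> Y\<kappa> del: transpose_matrix_vector)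
  define q where "q x = x \<bullet> (S0 *v x)" for x
  define f where "f r u = (X r *v u) \<bullet> (Y r *v u)" for r u
  have f0: "f 0 u = q u" for u
    by (simp add: f_def q_def X0 Y0)
  have f\<kappa>: "f \<kappa> u = q (C *v (X \<kappa> *v u))" for u
    unfolding f_def q_def alg' by (simp add: inner_matrix_vector_transpose del: transpose_matrix_vector)
  have dec: "f s u \<le> f r u" if "0 \<le> r" "r \<le> s" "s \<le> \<kappa>" for r s u
    unfolding f_def by (rule ham_pairing_decreasing [OF h Rt Qt that])
  define neg where "neg V \<longleftrightarrow> subspace V \<and> (\<forall>x\<in>V. x \<noteq> 0 \<longrightarrow> q x < 0)" for V
  have "\<exists>V. neg V \<and> (\<forall>U. neg U \<longrightarrow> dim U \<le> dim V)"
  proof (rule ex_has_greatest_nat [where k = "{0}" and b = "Suc CARD('n)"])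
    show "neg {0}" by (simp add: neg_def subspace_single_0)
    show "\<forall>U. neg U \<longrightarrow> dim U < Suc CARD('n)"
      by (simp add: less_Suc_eq_le dim_subset_UNIV_cart)
  qed
  then obtain V where V: "neg V" and max: "\<And>U. neg U \<Longrightarrow> dim U \<le> dim V" by blast
  have subV: "subspace V" and negV: "\<And>x. x \<in> V \<Longrightarrow> x \<noteq> 0 \<Longrightarrow> q x < 0"
    using V by (auto simp: neg_def)
  show "v = 0"
  proof (rule ccontr)
    assume v0: "v \<noteq> 0"
    have fv: "f t v = 0" by (simp add: f_def v)
    \<comment> \<open>The pairing starts at \<open>q v\<close> and has come down to 0 at time
      \<open>t\<close>, so \<open>q v\<close> is not negative.\<close>
    have "v \<notin> V"
      using negV [of v] v0 dec [of 0 t v] t fv f0 [of v] by auto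
    let ?U = "span (insert v V)"
    \<comment> \<open>\<open>v\<close> lies in the radical of the pairing at time \<open>t\<close>:
      \<open>X t\<close> kills it, and the symmetry of \<open>S0\<close> makes the conserved
      symplectic form zero.\<close>
    have ft: "f t (w + a *\<^sub>R v) = f t w" for w a
    proof -
      have "(X 0 *v w) \<bullet> (Y 0 *v v) - (X 0 *v v) \<bullet> (Y 0 *v w) = 0"
        using symmetric_mat_inner [OF S0, of w v] by (simp add: X0 Y0 inner_commute)
      then have "(X t *v w) \<bullet> (Y t *v v) = (X t *v v) \<bullet> (Y t *v w)"
        using ham_symplectic [OF h _ _ _ t, of 0 w v] Rt Qt t by (simp add: psd_mat_def)
      then show ?thesis
        by (simp add: f_def matrix_vector_right_distrib matrix_vector_mult_scaleR v inner_add_right)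
    qed
    have neg\<kappa>: "f \<kappa> u < 0" if u: "u \<in> ?U" "u \<noteq> 0" for u
    proof -
      obtain a where "u - a *\<^sub>R v \<in> span V"
        using u span_breakdown_eq by blast
      then have w: "u - a *\<^sub>R v \<in> V" using subV by (simp add: span_eq_iff [THEN iffD2])
      define w where "w = u - a *\<^sub>R v"
      have u_eq: "u = w + a *\<^sub>R v" by (simp add: w_def)
      have le: "f \<kappa> u \<le> f t w" using dec [of t \<kappa> u] t ft by (auto simp: u_eq)
      show ?thesis
      \<comment> \<open>If the component \<open>w\<close> in \<open>V\<close> is nonzero, the strict
        sign comes from \<open>q w\<close> at time 0. Otherwise \<open>u\<close> is a multiple of
        \<open>v\<close>, and a nonnegative \<open>f \<kappa> u\<close> would force
        \<open>X \<kappa> *v u = 0\<close>.\<close>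
      proof (cases "w = 0")
        case False
        have "f t w \<le> q w" using dec [of 0 t w] t f0 by auto
        also have "\<dots> < 0" using negV False w by (simp add: w_def)
        finally show ?thesis using le by simp
      next
        case True
        show ?thesis
        proof (rule ccontr)
          assume "\<not> f \<kappa> u < 0"
          then have "X \<kappa> *v u = 0"
            using v by (intro ham_degenerate [OF h Rt Qt t])
              (auto simp: f_def u_eq True matrix_vector_mult_scaleR)
          with inj u show False by blast
        qed
      qed
    qed
    let ?T = "(*v) (C ** X \<kappa>)"
    have T: "f \<kappa> u = q (?T u)" for u by (simp add: f\<kappa> matrix_vector_mul_assoc)
    have "neg (?T ` ?U)"
      unfolding neg_def
    proof (intro conjI ballI impI)
      show "subspace (?T ` ?U)" by (intro linear_subspace_image) auto
      fix x assume "x \<in> ?T ` ?U" "x \<noteq> 0"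
      then obtain u where u: "u \<in> ?U" "x = ?T u" by blast
      with \<open>x \<noteq> 0\<close> have "u \<noteq> 0" by auto
      with u show "q x < 0" using neg\<kappa> T by metis
    qed
    moreover have "inj_on ?T ?U"
    proof (subst linear_inj_on_iff_eq_0)
      show "\<forall>u\<in>?U. ?T u = 0 \<longrightarrow> u = 0"
      proof (intro ballI impI, rule ccontr)
        fix u assume "u \<in> ?U" "?T u = 0" "u \<noteq> 0"
        with neg\<kappa> T [of u] show False by (force simp: q_def)
      qed
    qed auto
    then have "dim (?T ` ?U) = dim ?U"
      by (intro dim_image_eq) (simp_all only: span_span matrix_vector_mul_linear)
    moreover have "dim ?U = dim V + 1"
      using \<open>v \<notin> V\<close> subV by (simp add: dim_insert span_eq_iff [THEN iffD2])
    ultimately show False using max by fastforce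
  qed
qed

lemma periodic_riccati_exists:
  fixes At Rt Qt :: "real^'n^'n"
  assumes P: "block_mat P11 P12 P21 P22 = mat_exp (\<kappa> *\<^sub>R block_mat At (- Rt) (- Qt) (- transpose At))"
    and Rt: "psd_mat Rt" and Qt: "psd_mat Qt" and S0: "symmetric_mat S0" and "\<kappa> > 0"
    and alg: "algebraic_periodic_riccati C P11 P12 P21 P22 S0"
  shows "\<exists>S. periodic_riccati \<kappa> At Rt Qt C S \<and> S 0 = S0"
proof -
  obtain X Y where
    "ham_sol \<kappa> At Rt Qt X Y" "X 0 = mat 1" "Y 0 = S0"
    "X \<kappa> = P11 ** mat 1 + P12 ** S0" "Y \<kappa> = P21 ** mat 1 + P22 ** S0"
    by (rule ham_sol_flow [OF P])
  then have h: "ham_sol \<kappa> At Rt Qt X Y" "X 0 = mat 1" "Y 0 = S0"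
    "X \<kappa> = P11 + P12 ** S0" "Y \<kappa> = P21 + P22 ** S0"
    by simp_all
  define S where "S t = Y t ** matrix_inv (X t)" for t
  have S: "riccati_ode \<kappa> At Rt Qt S"
    unfolding S_def
    by (intro riccati_ode_of_ham_sol h(1) ham_sol_invertible [OF P Rt Qt S0 alg h])
  have "invertible (X 0)"
    using \<open>\<kappa> > 0\<close> by (intro ham_sol_invertible [OF P Rt Qt S0 alg h]) auto
  then have "matrix_inv (X 0) = mat 1"
    using matrix_inv_right [of "X 0"] h by simp
  then have "S 0 = S0" by (simp add: S_def h)
  with S alg riccati_ode_terminal_iff [OF P S \<open>\<kappa> > 0\<close>] show ?thesis
    unfolding periodic_riccati_def by blast
qed

section \<open>Variation of constants and the periodic linear problem\<close>

lemma fundamental_matrix_inverse: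
  assumes \<Phi>: "fundamental_matrix \<kappa> M \<Phi>" and M: "continuous_on {0..\<kappa>} M" and s: "s \<in> {0..\<kappa>}"
  shows "invertible (\<Phi> s 0)"
    and "t \<in> {0..\<kappa>} \<Longrightarrow> \<Phi> t s = \<Phi> t 0 ** matrix_inv (\<Phi> s 0)"
proof -
  have d: "((\<lambda>t. \<Phi> t r) has_vector_derivative (M t ** \<Phi> t r)) (at t within {0..\<kappa>})"
    if "r \<in> {0..\<kappa>}" "t \<in> {0..\<kappa>}" for r t
    using \<Phi> that by (auto simp: fundamental_matrix_def)
  have ss: "\<Phi> r r = mat 1" if "r \<in> {0..\<kappa>}" for r
    using \<Phi> that by (auto simp: fundamental_matrix_def)
  \<comment> \<open>Both sides solve the same linear equation in \<open>t\<close> and agree at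
    \<open>s\<close>. At \<open>t = 0\<close> this exhibits an inverse of \<open>\<Phi> s 0\<close>;
    in general it expresses the dependence on the second argument, for which
    \<open>fundamental_matrix\<close> demands no regularity, through
    \<open>matrix_inv (\<Phi> s 0)\<close>.\<close>
  have cocycle: "\<Phi> t s ** \<Phi> s 0 = \<Phi> t 0" if t: "t \<in> {0..\<kappa>}" for t
  proof (rule matrix_ode_unique [OF _ _ M s _ t, where V = "\<lambda>t. \<Phi> t s ** \<Phi> s 0" and W = "\<lambda>t. \<Phi> t 0"])
    show "((\<lambda>t. \<Phi> t s ** \<Phi> s 0) has_vector_derivative M r ** (\<Phi> r s ** \<Phi> s 0)) (at r within {0..\<kappa>})"
      if "r \<in> {0..\<kappa>}" for r
      using has_vector_derivative_matrix_mult [OF d [OF s that] has_vector_derivative_const]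
      by (simp add: matrix_mul_assoc)
  qed (use s d ss in auto)
  have "\<Phi> 0 s ** \<Phi> s 0 = mat 1"
    using cocycle [of 0] ss [of 0] s by simp
  then show inv: "invertible (\<Phi> s 0)"
    by (auto simp: invertible_left_inverse)
  show "\<Phi> t s = \<Phi> t 0 ** matrix_inv (\<Phi> s 0)" if "t \<in> {0..\<kappa>}"
    using cocycle [OF that] matrix_inv_right [OF inv] by (metis matrix_mul_assoc matrix_mul_rid)
qed

text \<open>With \<open>U\<close> the inverse of \<open>\<Psi>\<close> one has U' = -U M, hence (U
  c)' = -U g for every solution \<open>c\<close>. Integrating this gives the formula, and solving it
  for \<open>c\<close> gives the solution.\<close>

lemma
  fixes M :: "real \<Rightarrow> real^'n^'n" and g :: "real \<Rightarrow> real^'n"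
  assumes \<Phi>: "fundamental_matrix \<kappa> M \<Phi>" and M: "continuous_on {0..\<kappa>} M"
    and g: "continuous_on {0..\<kappa>} g" and "\<kappa> > 0"
  shows inhomogeneous_ode_exists:
      "\<exists>c. (\<forall>t\<in>{0..\<kappa>}. (c has_vector_derivative (M t *v c t - g t)) (at t within {0..\<kappa>})) \<and> c 0 = c0"
    and variation_of_constants:
      "(\<And>t. t \<in> {0..\<kappa>} \<Longrightarrow> (c has_vector_derivative (M t *v c t - g t)) (at t within {0..\<kappa>})) \<Longrightarrow>
      c \<kappa> = \<Phi> \<kappa> 0 *v c 0 - integral {0..\<kappa>} (\<lambda>\<tau>. \<Phi> \<kappa> \<tau> *v g \<tau>)"
proof -
  define \<Psi> where "\<Psi> = (\<lambda>t. \<Phi> t 0)"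
  define U where "U t = matrix_inv (\<Psi> t)" for t
  have inv: "invertible (\<Psi> t)" if "t \<in> {0..\<kappa>}" for t
    unfolding \<Psi>_def by (rule fundamental_matrix_inverse [OF \<Phi> M that])
  have \<Psi>0: "\<Psi> 0 = mat 1"
    using \<Phi> \<open>\<kappa> > 0\<close> by (auto simp: fundamental_matrix_def \<Psi>_def)
  have U0: "U 0 = mat 1"
    using matrix_inv_left [OF inv [of 0]] \<open>\<kappa> > 0\<close> by (simp add: U_def \<Psi>0)
  have \<Psi>U: "\<Psi> t ** U t = mat 1" if "t \<in> {0..\<kappa>}" for t
    using matrix_inv_right [OF inv [OF that]] by (simp add: U_def)
  have d\<Psi>: "(\<Psi> has_vector_derivative (M t ** \<Psi> t)) (at t within {0..\<kappa>})" if "t \<in> {0..\<kappa>}" for t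
    using \<Phi> that \<open>\<kappa> > 0\<close> by (auto simp: fundamental_matrix_def \<Psi>_def)
  have dU: "(U has_vector_derivative - (U t ** M t)) (at t within {0..\<kappa>})" if "t \<in> {0..\<kappa>}" for t
    using has_vector_derivative_matrix_inv [OF d\<Psi> inv that, folded U_def] \<Psi>U [OF that]
    by (metis matrix_mul_assoc matrix_mul_rid)
  have contU: "continuous_on {0..\<kappa>} U"
    by (rule continuous_on_vector_derivative [OF dU])
  have contUg: "continuous_on {0..\<kappa>} (\<lambda>\<tau>. U \<tau> *v g \<tau>)"
    by (intro continuous_on_matrix_vector_mult contU g)
  show "\<exists>c. (\<forall>t\<in>{0..\<kappa>}. (c has_vector_derivative (M t *v c t - g t)) (at t within {0..\<kappa>})) \<and> c 0 = c0"
  proof -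
    let ?c = "\<lambda>t. \<Psi> t *v (c0 - integral {0..t} (\<lambda>\<tau>. U \<tau> *v g \<tau>))"
    have c0: "?c 0 = c0" by (simp add: \<Psi>0)
    have dc: "(?c has_vector_derivative M t *v ?c t - g t) (at t within {0..\<kappa>})"
      if t: "t \<in> {0..\<kappa>}" for t
    proof -
      have "((\<lambda>t. c0 - integral {0..t} (\<lambda>\<tau>. U \<tau> *v g \<tau>)) has_vector_derivative 0 - U t *v g t)
          (at t within {0..\<kappa>})"
        by (intro has_vector_derivative_diff has_vector_derivative_const
            integral_has_vector_derivative contUg t)
      from has_vector_derivative_matrix_vector_mult [OF d\<Psi> [OF t] this]
      show ?thesis
        by (rule has_vector_derivative_eq_rhs)
          (simp add: matrix_vector_mul_assoc matrix_vector_mult_uminus_right \<Psi>U [OF t])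
    qed
    from c0 dc show ?thesis by blast
  qed
  show "c \<kappa> = \<Phi> \<kappa> 0 *v c 0 - integral {0..\<kappa>} (\<lambda>\<tau>. \<Phi> \<kappa> \<tau> *v g \<tau>)"
    if c: "\<And>t. t \<in> {0..\<kappa>} \<Longrightarrow> (c has_vector_derivative (M t *v c t - g t)) (at t within {0..\<kappa>})"
  proof -
    have "((\<lambda>t. U t *v c t) has_vector_derivative - (U t *v g t)) (at t within {0..\<kappa>})"
      if t: "t \<in> {0..\<kappa>}" for t
      using has_vector_derivative_matrix_vector_mult [OF dU [OF t] c [OF t]]
      by (rule has_vector_derivative_eq_rhs)
        (simp add: matrix_vector_mult_diff_distrib matrix_vector_mul_assoc matrix_vector_mult_uminus_left)
    then have "((\<lambda>t. - (U t *v g t)) has_integral (U \<kappa> *v c \<kappa> - U 0 *v c 0)) {0..\<kappa>}"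
      using \<open>\<kappa> > 0\<close> by (intro fundamental_theorem_of_calculus) auto
    from has_integral_neg [OF this]
    have "((\<lambda>t. U t *v g t) has_integral (c 0 - U \<kappa> *v c \<kappa>)) {0..\<kappa>}"
      by (simp add: U0)
    from has_integral_linear [OF this, of "(*v) (\<Psi> \<kappa>)"]
    have "((\<lambda>t. \<Psi> \<kappa> *v (U t *v g t)) has_integral (\<Psi> \<kappa> *v c 0 - c \<kappa>)) {0..\<kappa>}"
      using \<Psi>U [of \<kappa>] \<open>\<kappa> > 0\<close>
      by (simp add: o_def matrix_vector_mult_diff_distrib matrix_vector_mul_assoc linear_linear)
    moreover have "\<Psi> \<kappa> *v (U t *v g t) = \<Phi> \<kappa> t *v g t" if "t \<in> {0..\<kappa>}" for t
      using fundamental_matrix_inverse(2) [OF \<Phi> M that, of \<kappa>] \<open>\<kappa> > 0\<close>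
      by (simp add: \<Psi>_def U_def matrix_vector_mul_assoc)
    ultimately have "((\<lambda>t. \<Phi> \<kappa> t *v g t) has_integral (\<Psi> \<kappa> *v c 0 - c \<kappa>)) {0..\<kappa>}"
      by (subst has_integral_cong [symmetric]) auto
    then show ?thesis
      by (simp add: integral_unique \<Psi>_def)
  qed
qed

text \<open>Variation of constants turns the boundary condition into a linear equation for the
  initial value, with matrix \<open>\<Phi> \<kappa> 0 - transpose C\<close>. For existence, the
  differential equation is started at the solution of this linear equation.\<close>

lemma periodic_linear_solution:
  fixes At Rt C :: "real^'n^'n"
  assumes S: "riccati_ode \<kappa> At Rt Qt S" and "\<kappa> > 0"
    and \<Phi>: "fundamental_matrix \<kappa> (\<lambda>t. - transpose At + S t ** Rt) \<Phi>"
    and inv: "invertible (\<Phi> \<kappa> 0 - transpose C)"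
  shows "(\<exists>c. periodic_linear \<kappa> At Rt C b S c) \<and>
    (\<forall>c. periodic_linear \<kappa> At Rt C b S c \<longrightarrow>
       c 0 = matrix_inv (\<Phi> \<kappa> 0 - transpose C) *v
         integral {0..\<kappa>} (\<lambda>\<tau>. (\<Phi> \<kappa> \<tau> ** S \<tau>) *v b))"
proof -
  define I where "I = integral {0..\<kappa>} (\<lambda>\<tau>. (\<Phi> \<kappa> \<tau> ** S \<tau>) *v b)"
  have contS: "continuous_on {0..\<kappa>} S"
    using S unfolding riccati_ode_def by (intro continuous_on_vector_derivative) auto
  have M: "continuous_on {0..\<kappa>} (\<lambda>t. - transpose At + S t ** Rt)"
    by (intro continuous_intros continuous_on_matrix_mult contS)
  have g: "continuous_on {0..\<kappa>} (\<lambda>t. S t *v b)"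
    by (intro continuous_on_matrix_vector_mult contS continuous_intros)
  have end_value: "c \<kappa> = \<Phi> \<kappa> 0 *v c 0 - I"
    if "\<forall>t\<in>{0..\<kappa>}. (c has_vector_derivative ((- transpose At + S t ** Rt) *v c t - S t *v b))
         (at t within {0..\<kappa>})" for c
    using variation_of_constants [OF \<Phi> M g \<open>\<kappa> > 0\<close>, of c] that
    by (simp add: I_def matrix_vector_mul_assoc)
  have iff: "\<Phi> \<kappa> 0 *v c0 - I = transpose C *v c0 \<longleftrightarrow> c0 = matrix_inv (\<Phi> \<kappa> 0 - transpose C) *v I" for c0
  proof -
    have "\<Phi> \<kappa> 0 *v c0 - I = transpose C *v c0 \<longleftrightarrow> (\<Phi> \<kappa> 0 - transpose C) *v c0 = I"
      by (auto simp add: matrix_vector_mult_diff_rdistrib algebra_simps)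
    also have "\<dots> \<longleftrightarrow> c0 = matrix_inv (\<Phi> \<kappa> 0 - transpose C) *v I"
      using matrix_inv_left [OF inv] matrix_inv_right [OF inv]
      by (metis matrix_vector_mul_assoc matrix_vector_mul_lid)
    finally show ?thesis .
  qed
  show ?thesis
    unfolding I_def [symmetric]
  proof (intro conjI allI impI)
    obtain c where "\<forall>t\<in>{0..\<kappa>}. (c has_vector_derivative ((- transpose At + S t ** Rt) *v c t - S t *v b))
         (at t within {0..\<kappa>})" "c 0 = matrix_inv (\<Phi> \<kappa> 0 - transpose C) *v I"
      using inhomogeneous_ode_exists [OF \<Phi> M g \<open>\<kappa> > 0\<close>] by blast
    with end_value iff have "periodic_linear \<kappa> At Rt C b S c"
      unfolding periodic_linear_def by metis
    then show "\<exists>c. periodic_linear \<kappa> At Rt C b S c" by blast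
  next
    fix c assume "periodic_linear \<kappa> At Rt C b S c"
    with end_value iff show "c 0 = matrix_inv (\<Phi> \<kappa> 0 - transpose C) *v I"
      unfolding periodic_linear_def by metis
  qed
qed

section \<open>The optimal cost over one period\<close>

text \<open>The function \<open>J\<close> is an upper bound for the accumulated cost; only its increments matter.\<close>

definition controlled ::
  "real \<Rightarrow> real^'n^'n \<Rightarrow> real^'m^'n \<Rightarrow> real^'n^'n \<Rightarrow> real^'m^'m \<Rightarrow>
    (real \<Rightarrow> real^'n) \<Rightarrow> (real \<Rightarrow> real^'m) \<Rightarrow> (real \<Rightarrow> real) \<Rightarrow> bool" where
  "controlled \<kappa> A B Q R \<xi> v J \<longleftrightarrow> (\<forall>t\<in>{0..\<kappa>}.
    (\<xi> has_vector_derivative (A *v \<xi> t + B *v v t)) (at t within {0..\<kappa>}) \<and>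
    (\<exists>J'. (J has_real_derivative J') (at t within {0..\<kappa>}) \<and>
      \<xi> t \<bullet> (Q *v \<xi> t) + v t \<bullet> (R *v v t) \<le> J'))"

text \<open>\<open>G\<close> is the matrix of the value function: a lower bound over all controls,
  together with its attainment. Optimality is encoded without a feedback law, which makes the
  comparison of different terminal costs direct.\<close>

definition value_matrix ::
  "real \<Rightarrow> real^'n^'n \<Rightarrow> real^'m^'n \<Rightarrow> real^'n^'n \<Rightarrow> real^'m^'m \<Rightarrow> real^'n^'n \<Rightarrow> real^'n^'n \<Rightarrow> bool"
  where "value_matrix \<kappa> A B Q R T G \<longleftrightarrow>
    (\<forall>\<xi> v J. controlled \<kappa> A B Q R \<xi> v J \<longrightarrow>
      \<xi> 0 \<bullet> (G *v \<xi> 0) \<le> J \<kappa> - J 0 + \<xi> \<kappa> \<bullet> (T *v \<xi> \<kappa>)) \<and>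
    (\<forall>x. \<exists>\<xi> v J. controlled \<kappa> A B Q R \<xi> v J \<and> \<xi> 0 = x \<and>
      x \<bullet> (G *v x) = J \<kappa> - J 0 + \<xi> \<kappa> \<bullet> (T *v \<xi> \<kappa>))"

text \<open>The optimal control for the larger terminal cost competes in the problem with the
  smaller one.\<close>

lemma value_matrix_mono:
  assumes "value_matrix \<kappa> A B Q R T G" "value_matrix \<kappa> A B Q R T' G'"
    and le: "\<And>x. x \<bullet> (T *v x) \<le> x \<bullet> (T' *v x)"
  shows "x \<bullet> (G *v x) \<le> x \<bullet> (G' *v x)"
proof -
  obtain \<xi> v J where \<xi>: "controlled \<kappa> A B Q R \<xi> v J" "\<xi> 0 = x"
      "x \<bullet> (G' *v x) = J \<kappa> - J 0 + \<xi> \<kappa> \<bullet> (T' *v \<xi> \<kappa>)"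
    using assms(2) unfolding value_matrix_def by blast
  then have "x \<bullet> (G *v x) \<le> J \<kappa> - J 0 + \<xi> \<kappa> \<bullet> (T *v \<xi> \<kappa>)"
    using assms(1) unfolding value_matrix_def by blast
  with le [of "\<xi> \<kappa>"] \<xi> show ?thesis by simp
qed

lemma pd_mat_invertible: "pd_mat R \<Longrightarrow> invertible R"
  by (rule invertible_if_injective) (force simp: pd_mat_def)

lemma pd_mat_nonneg: "pd_mat R \<Longrightarrow> 0 \<le> x \<bullet> (R *v x)"
  unfolding pd_mat_def by (cases "x = 0") (auto intro: less_imp_le)

lemma pd_mat_inverse:
  assumes "pd_mat R"
  shows "symmetric_mat (matrix_inv R)" "R *v (matrix_inv R *v x) = x" "0 \<le> x \<bullet> (matrix_inv R *v x)"
proof -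
  have inv: "invertible R" using assms by (rule pd_mat_invertible)
  have sym: "symmetric_mat R" using assms by (simp add: pd_mat_def)
  show R: "R *v (matrix_inv R *v x) = x" for x
    using matrix_inv_right [OF inv] by (simp add: matrix_vector_mul_assoc)
  have "transpose (matrix_inv R) ** R = mat 1"
    using arg_cong [OF matrix_inv_right [OF inv], of transpose] sym
    by (simp add: matrix_transpose_mul symmetric_mat_def)
  then show "symmetric_mat (matrix_inv R)"
    using matrix_inv_right [OF inv] unfolding symmetric_mat_def
    by (metis matrix_mul_assoc matrix_mul_lid matrix_mul_rid)
  show "0 \<le> x \<bullet> (matrix_inv R *v x)"
  proof -
    have "0 \<le> (matrix_inv R *v x) \<bullet> (R *v (matrix_inv R *v x))"
      by (rule pd_mat_nonneg [OF assms])
    then show ?thesis by (simp add: R inner_commute)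
  qed
qed

lemma symmetric_matI:
  assumes "\<And>x y. x \<bullet> (M *v y) = y \<bullet> (M *v x)"
  shows "symmetric_mat M"
proof -
  have "x \<bullet> (transpose M *v y) = x \<bullet> (M *v y)" for x y
    using inner_matrix_vector_transpose [of x "transpose M" y] assms [of x y]
    by (simp add: inner_commute del: transpose_matrix_vector)
  then have "transpose M *v y = M *v y" for y
    using vector_eq_ldot by blast
  then show ?thesis
    unfolding symmetric_mat_def matrix_eq by blast
qed

lemma psd_mat_control_weight:
  assumes R: "pd_mat R"
  shows "psd_mat (B ** matrix_inv R ** transpose B)"
proof -
  have eq: "x \<bullet> ((B ** matrix_inv R ** transpose B) *v y) =
      (transpose B *v x) \<bullet> (matrix_inv R *v (transpose B *v y))" for x y
    by (simp add: inner_matrix_vector_transpose flip: matrix_vector_mul_assoc del: transpose_matrix_vector)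
  have "symmetric_mat (B ** matrix_inv R ** transpose B)"
  proof (rule symmetric_matI)
    fix x y
    show "x \<bullet> ((B ** matrix_inv R ** transpose B) *v y) = y \<bullet> ((B ** matrix_inv R ** transpose B) *v x)"
      unfolding eq symmetric_mat_inner [OF pd_mat_inverse(1) [OF R], of "transpose B *v x"]
      by (rule inner_commute)
  qed
  then show ?thesis
    unfolding psd_mat_def eq using pd_mat_inverse(3) [OF R] by blast
qed

text \<open>The Hamiltonian system is solved backwards from (Id, T) at time \<open>\<kappa>\<close>,
  and G = Y(0) X(0)^(-1). The cost of any control exceeds x' G x by at least three nonnegative
  terms: the squared deviations from the extremal in control (weight \<open>R\<close>), in state
  (weight \<open>Q\<close>) and in final state (weight \<open>T\<close>).\<close>

lemma value_matrix_exists: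
  fixes A Q Rt T :: "real^'n^'n" and B :: "real^'m^'n" and R :: "real^'m^'m"
  assumes P: "block_mat P11 P12 P21 P22 = mat_exp (\<kappa> *\<^sub>R block_mat A (- Rt) (- Q) (- transpose A))"
    and "\<kappa> > 0" and R: "pd_mat R" and Rt: "Rt = B ** matrix_inv R ** transpose B"
    and Q: "psd_mat Q" and T: "psd_mat T"
  shows "\<exists>G. psd_mat G \<and> T ** (P11 + P12 ** G) = P21 + P22 ** G \<and> value_matrix \<kappa> A B Q R T G"
proof -
  have psdRt: "psd_mat Rt" unfolding Rt by (rule psd_mat_control_weight [OF R])
  then have symRt: "symmetric_mat Rt" by (simp add: psd_mat_def)
  have symQ: "symmetric_mat Q" and symT: "symmetric_mat T" using Q T by (auto simp: psd_mat_def)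
  obtain N11 N12 N21 N22 where "block_mat P11 P12 P21 P22 ** block_mat N11 N12 N21 N22 = mat 1"
    using ham_flow_inverse [OF P] by blast
  then have N: "P11 ** N11 + P12 ** N21 = mat 1" "P11 ** N12 + P12 ** N22 = 0"
      "P21 ** N11 + P22 ** N21 = 0" "P21 ** N12 + P22 ** N22 = mat 1"
    by (simp_all add: block_mat_mult block_mat_one block_mat_inject)
  \<comment> \<open>These initial data are the inverse flow applied to (Id, T).\<close>
  obtain X Y where h: "ham_sol \<kappa> A Rt Q X Y" and X0: "X 0 = N11 + N12 ** T" and Y0: "Y 0 = N21 + N22 ** T"
    and "X \<kappa> = P11 ** (N11 + N12 ** T) + P12 ** (N21 + N22 ** T)"
    and "Y \<kappa> = P21 ** (N11 + N12 ** T) + P22 ** (N21 + N22 ** T)"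
    by (rule ham_sol_flow [OF P])
  then have X\<kappa>: "X \<kappa> = P11 ** X 0 + P12 ** Y 0" and Y\<kappa>: "Y \<kappa> = P21 ** X 0 + P22 ** Y 0"
    by simp_all
  have "X \<kappa> = (P11 ** N11 + P12 ** N21) + (P11 ** N12 + P12 ** N22) ** T"
    unfolding X\<kappa> X0 Y0 by (simp add: matrix_ring_simps)
  then have X\<kappa>1: "X \<kappa> = mat 1" by (simp add: N)
  have "Y \<kappa> = (P21 ** N11 + P22 ** N21) + (P21 ** N12 + P22 ** N22) ** T"
    unfolding Y\<kappa> X0 Y0 by (simp add: matrix_ring_simps)
  then have Y\<kappa>T: "Y \<kappa> = T" by (simp add: N)
  have inv: "invertible (X 0)"
  proof (rule invertible_if_injective)
    fix w assume "X 0 *v w = 0"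
    \<comment> \<open>At time \<open>\<kappa>\<close> the pairing equals the terminal cost
      \<open>w \<bullet> (T *v w)\<close>, which is nonnegative.\<close>
    then have "X \<kappa> *v w = 0"
      using \<open>\<kappa> > 0\<close> T by (intro ham_degenerate [OF h psdRt Q, of 0]) (auto simp: X\<kappa>1 Y\<kappa>T psd_mat_def)
    then show "w = 0" by (simp add: X\<kappa>1)
  qed
  define G where "G = Y 0 ** matrix_inv (X 0)"
  have GX: "G ** X 0 = Y 0"
    using matrix_inv_left [OF inv] by (simp add: G_def flip: matrix_mul_assoc)
  have onto: "\<exists>w. x = X 0 *v w \<and> G *v x = Y 0 *v w" for x
    using matrix_inv_right [OF inv]
    by (intro exI [of _ "matrix_inv (X 0) *v x"]) (simp add: matrix_vector_mul_assoc G_def)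
  have "T ** (P11 + P12 ** G) ** X 0 = T ** X \<kappa>"
    unfolding X\<kappa> GX [symmetric] by (simp add: matrix_ring_simps)
  also have "\<dots> = Y \<kappa>" by (simp add: X\<kappa>1 Y\<kappa>T)
  also have "\<dots> = (P21 + P22 ** G) ** X 0"
    unfolding Y\<kappa> GX [symmetric] by (simp add: matrix_ring_simps)
  finally have alg: "T ** (P11 + P12 ** G) = P21 + P22 ** G"
    by (rule invertible_mult_right_cancel [OF inv])
  have symG: "symmetric_mat G"
  proof (rule symmetric_matI)
    fix x y
    obtain v w where v: "x = X 0 *v v" "G *v x = Y 0 *v v" and w: "y = X 0 *v w" "G *v y = Y 0 *v w"
      using onto by metis
    have "x \<bullet> (G *v y) - y \<bullet> (G *v x) = v \<bullet> (T *v w) - w \<bullet> (T *v v)"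
      using ham_symplectic [OF h symRt symQ, of 0 \<kappa> v w] \<open>\<kappa> > 0\<close>
      by (simp add: X\<kappa>1 Y\<kappa>T flip: v w)
    also have "\<dots> = 0" using symmetric_mat_inner [OF symT, of v w] by (simp add: inner_commute)
    finally show "x \<bullet> (G *v y) = y \<bullet> (G *v x)" by simp
  qed
  have nonnegG: "0 \<le> x \<bullet> (G *v x)" for x
  proof -
    obtain w where w: "x = X 0 *v w" "G *v x = Y 0 *v w" using onto by metis
    have "0 \<le> w \<bullet> (T *v w)" using T by (simp add: psd_mat_def)
    also have "\<dots> \<le> x \<bullet> (G *v x)"
      using ham_pairing_decreasing [OF h psdRt Q, of 0 \<kappa> w] \<open>\<kappa> > 0\<close> by (simp add: X\<kappa>1 Y\<kappa>T flip: w)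
    finally show ?thesis .
  qed
  have dx: "((\<lambda>t. X t *v w) has_vector_derivative (A *v (X t *v w) - Rt *v (Y t *v w))) (at t within {0..\<kappa>})"
    and dy: "((\<lambda>t. Y t *v w) has_vector_derivative (- (Q *v (X t *v w)) - transpose A *v (Y t *v w)))
      (at t within {0..\<kappa>})"
    if "t \<in> {0..\<kappa>}" for t w
  proof -
    have "(X has_vector_derivative (A ** X t - Rt ** Y t)) (at t within {0..\<kappa>})"
      using h that by (auto simp: ham_sol_def)
    from has_vector_derivative_matrix_vector_mult [OF this has_vector_derivative_const [of w]]
    show "((\<lambda>t. X t *v w) has_vector_derivative (A *v (X t *v w) - Rt *v (Y t *v w))) (at t within {0..\<kappa>})"
      by (simp add: matrix_vector_mult_diff_rdistrib matrix_vector_mul_assoc)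
    have "(Y has_vector_derivative (- (Q ** X t) - transpose A ** Y t)) (at t within {0..\<kappa>})"
      using h that by (auto simp: ham_sol_def)
    from has_vector_derivative_matrix_vector_mult [OF this has_vector_derivative_const [of w]]
    show "((\<lambda>t. Y t *v w) has_vector_derivative (- (Q *v (X t *v w)) - transpose A *v (Y t *v w)))
      (at t within {0..\<kappa>})"
      by (simp add: matrix_vector_mult_diff_rdistrib matrix_vector_mult_uminus_left
          matrix_vector_mul_assoc del: transpose_matrix_vector)
  qed
  have Rt_form: "y \<bullet> (Rt *v y) = (transpose B *v y) \<bullet> (matrix_inv R *v (transpose B *v y))" for y
    unfolding Rt
    by (simp add: inner_matrix_vector_transpose flip: matrix_vector_mul_assoc del: transpose_matrix_vector)
  have "\<xi> 0 \<bullet> (G *v \<xi> 0) \<le> J \<kappa> - J 0 + \<xi> \<kappa> \<bullet> (T *v \<xi> \<kappa>)" if c: "controlled \<kappa> A B Q R \<xi> v J" for \<xi> v J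
  proof -
    obtain w where w: "\<xi> 0 = X 0 *v w" "G *v \<xi> 0 = Y 0 *v w" using onto by metis
    have d\<xi>: "(\<xi> has_vector_derivative (A *v \<xi> t + B *v v t)) (at t within {0..\<kappa>})"
      if "t \<in> {0..\<kappa>}" for t
      using c that unfolding controlled_def by blast
    have "\<forall>t\<in>{0..\<kappa>}. \<exists>J'. (J has_real_derivative J') (at t within {0..\<kappa>}) \<and>
        \<xi> t \<bullet> (Q *v \<xi> t) + v t \<bullet> (R *v v t) \<le> J'"
      using c unfolding controlled_def by blast
    from bchoice [OF this] obtain J' where
      dJ: "\<And>t. t \<in> {0..\<kappa>} \<Longrightarrow> (J has_real_derivative J' t) (at t within {0..\<kappa>})"
      and J': "\<And>t. t \<in> {0..\<kappa>} \<Longrightarrow> \<xi> t \<bullet> (Q *v \<xi> t) + v t \<bullet> (R *v v t) \<le> J' t"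
      by blast
    define x where "x t = X t *v w" for t
    define y where "y t = Y t *v w" for t
    \<comment> \<open>\<open>(x, y)\<close> is the extremal with the same initial state as
      \<open>\<xi>\<close>. After the \<open>A\<close> terms cancel, \<open>?\<psi>'\<close> is at
      most minus the squares of v + R^(-1) B' y in \<open>R\<close> and of \<xi> - x in
      \<open>Q\<close>; the boundary values leave the square in \<open>T\<close>.\<close>
    let ?\<psi> = "\<lambda>t. x t \<bullet> y t - 2 * (\<xi> t \<bullet> y t) - J t"
    let ?\<psi>' = "\<lambda>t. (A *v x t - Rt *v y t) \<bullet> y t + x t \<bullet> (- (Q *v x t) - transpose A *v y t) -
      2 * ((A *v \<xi> t + B *v v t) \<bullet> y t + \<xi> t \<bullet> (- (Q *v x t) - transpose A *v y t)) - J' t"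
    have "?\<psi> \<kappa> \<le> ?\<psi> 0"
    proof (rule derivative_nonpos_imp_le [where f = ?\<psi>])
      fix t assume t: "t \<in> {0..\<kappa>}"
      show "(?\<psi> has_real_derivative ?\<psi>' t) (at t within {0..\<kappa>})"
        unfolding x_def y_def
        by (intro DERIV_diff DERIV_cmult has_vector_derivative_inner dx dy d\<xi> dJ t)
      define z where "z = matrix_inv R *v (transpose B *v y t)"
      have Rz: "R *v z = transpose B *v y t" unfolding z_def by (rule pd_mat_inverse [OF R])
      have "0 \<le> (v t + z) \<bullet> (R *v (v t + z))"
        by (rule pd_mat_nonneg [OF R])
      also have "\<dots> = v t \<bullet> (R *v v t) + 2 * (v t \<bullet> (transpose B *v y t)) + y t \<bullet> (Rt *v y t)"
        using R symmetric_mat_inner [of R z "v t"] unfolding Rt_form z_def [symmetric]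
        by (simp add: matrix_vector_right_distrib inner_add_left inner_add_right Rz pd_mat_def
            inner_commute del: transpose_matrix_vector)
      also have "v t \<bullet> (transpose B *v y t) = (B *v v t) \<bullet> y t"
        by (simp add: inner_matrix_vector_transpose del: transpose_matrix_vector)
      finally have 1: "0 \<le> v t \<bullet> (R *v v t) + 2 * ((B *v v t) \<bullet> y t) + y t \<bullet> (Rt *v y t)" .
      have "0 \<le> (\<xi> t - x t) \<bullet> (Q *v (\<xi> t - x t))"
        using Q by (simp add: psd_mat_def)
      also have "\<dots> = \<xi> t \<bullet> (Q *v \<xi> t) - 2 * (\<xi> t \<bullet> (Q *v x t)) + x t \<bullet> (Q *v x t)"
        using symmetric_mat_inner [OF symQ, of "x t" "\<xi> t"]
        by (simp add: matrix_vector_mult_diff_distrib inner_diff_left inner_diff_right inner_commute)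
      finally have 2: "0 \<le> \<xi> t \<bullet> (Q *v \<xi> t) - 2 * (\<xi> t \<bullet> (Q *v x t)) + x t \<bullet> (Q *v x t)" .
      have tr: "u \<bullet> (transpose A *v y t) = (A *v u) \<bullet> y t" for u
        by (simp add: inner_matrix_vector_transpose del: transpose_matrix_vector)
      show "?\<psi>' t \<le> 0"
        using 1 2 J' [OF t]
        by (simp add: inner_diff_left inner_diff_right inner_add_left tr inner_commute [of "Rt *v y t"]
            del: transpose_matrix_vector)
    qed (use \<open>\<kappa> > 0\<close> in simp)
    moreover have "?\<psi> 0 = - (\<xi> 0 \<bullet> (G *v \<xi> 0)) - J 0"
      by (simp add: x_def y_def flip: w)
    moreover have "2 * (\<xi> \<kappa> \<bullet> y \<kappa>) - x \<kappa> \<bullet> y \<kappa> \<le> \<xi> \<kappa> \<bullet> (T *v \<xi> \<kappa>)"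
    proof -
      have "0 \<le> (\<xi> \<kappa> - w) \<bullet> (T *v (\<xi> \<kappa> - w))"
        using T by (simp add: psd_mat_def)
      also have "\<dots> = \<xi> \<kappa> \<bullet> (T *v \<xi> \<kappa>) - 2 * (\<xi> \<kappa> \<bullet> (T *v w)) + w \<bullet> (T *v w)"
        using symmetric_mat_inner [OF symT, of w "\<xi> \<kappa>"]
        by (simp add: matrix_vector_mult_diff_distrib inner_diff_left inner_diff_right inner_commute)
      finally show ?thesis by (simp add: x_def y_def X\<kappa>1 Y\<kappa>T)
    qed
    ultimately show ?thesis by linarith
  qed
  moreover have "\<exists>\<xi> v J. controlled \<kappa> A B Q R \<xi> v J \<and> \<xi> 0 = a \<and>
      a \<bullet> (G *v a) = J \<kappa> - J 0 + \<xi> \<kappa> \<bullet> (T *v \<xi> \<kappa>)" for a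
  proof -
    obtain w where w: "a = X 0 *v w" "G *v a = Y 0 *v w" using onto by metis
    \<comment> \<open>The extremal control. By \<open>ham_pairing\<close> its running cost is
      exactly the rate at which the pairing decreases, so minus the pairing serves as accumulated
      cost.\<close>
    define v where "v t = - (matrix_inv R *v (transpose B *v (Y t *v w)))" for t
    have "controlled \<kappa> A B Q R (\<lambda>t. X t *v w) v (\<lambda>t. - ((X t *v w) \<bullet> (Y t *v w)))"
      unfolding controlled_def
    proof (intro ballI conjI exI)
      fix t assume t: "t \<in> {0..\<kappa>}"
      have "B *v v t = - (Rt *v (Y t *v w))"
        by (simp add: v_def Rt matrix_vector_mult_uminus_right matrix_vector_mul_assoc
            matrix_mul_assoc del: transpose_matrix_vector)
      then show "((\<lambda>t. X t *v w) has_vector_derivative A *v (X t *v w) + B *v v t) (at t within {0..\<kappa>})"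
        using dx [OF t] by simp
      show "((\<lambda>t. - ((X t *v w) \<bullet> (Y t *v w))) has_real_derivative
          - (- ((Y t *v w) \<bullet> (Rt *v (Y t *v w))) - (X t *v w) \<bullet> (Q *v (X t *v w)))) (at t within {0..\<kappa>})"
        by (intro DERIV_minus ham_pairing [OF h symRt t])
      show "(X t *v w) \<bullet> (Q *v (X t *v w)) + v t \<bullet> (R *v v t) \<le>
          - (- ((Y t *v w) \<bullet> (Rt *v (Y t *v w))) - (X t *v w) \<bullet> (Q *v (X t *v w)))"
        by (simp add: v_def Rt_form matrix_vector_mult_uminus_right pd_mat_inverse(2) [OF R]
            inner_commute del: transpose_matrix_vector)
    qed
    moreover have "a \<bullet> (G *v a) = - ((X \<kappa> *v w) \<bullet> (Y \<kappa> *v w)) - - ((X 0 *v w) \<bullet> (Y 0 *v w))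
        + (X \<kappa> *v w) \<bullet> (T *v (X \<kappa> *v w))"
      by (simp add: X\<kappa>1 Y\<kappa>T flip: w)
    ultimately show ?thesis
      using w(1) by (intro exI [of _ "\<lambda>t. X t *v w"] exI [of _ v]
          exI [of _ "\<lambda>t. - ((X t *v w) \<bullet> (Y t *v w))"] conjI) simp_all
  qed
  ultimately have "value_matrix \<kappa> A B Q R T G"
    unfolding value_matrix_def by blast
  with alg symG nonnegG show ?thesis
    unfolding psd_mat_def by blast
qed

section \<open>Linear algebra for the Hautus condition\<close>

text \<open>This is p(M) z, expressed through the orbit of \<open>z\<close>.\<close>

definition poly_apply :: "complex^'n^'n \<Rightarrow> complex poly \<Rightarrow> complex^'n \<Rightarrow> complex^'n" where
  "poly_apply M p z = (\<Sum>i\<le>degree p. coeff p i *s (((*v) M ^^ i) z))"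

lemma poly_apply_eq:
  assumes "degree p \<le> N"
  shows "poly_apply M p z = (\<Sum>i\<le>N. coeff p i *s (((*v) M ^^ i) z))"
  unfolding poly_apply_def
  by (rule sum.mono_neutral_left) (use assms in \<open>auto simp: coeff_eq_0\<close>)

lemma funpow_matrix_diff_scale:
  fixes M :: "complex^'n^'n"
  shows "((*v) M ^^ i) (M *v z - a *s z) = ((*v) M ^^ Suc i) z - a *s ((*v) M ^^ i) z"
  by (induction i) (simp_all add: matrix_vector_mult_diff_distrib vector_scalar_commute)

text \<open>The factor M - a can be put next to \<open>z\<close> or moved outside; the induction
  over annihilating polynomials needs both forms.\<close>

lemma poly_apply_linear_factor:
  fixes M :: "complex^'n^'n"
  shows "poly_apply M ([:- a, 1:] * q) z = poly_apply M q (M *v z - a *s z)"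
    and "poly_apply M q (M *v z - a *s z) = M *v poly_apply M q z - a *s poly_apply M q z"
proof -
  let ?f = "\<lambda>i. ((*v) M ^^ i) z" and ?N = "degree q"
  have deg: "degree ([:- a, 1:] * q) \<le> Suc ?N"
    using degree_mult_le [of "[:- a, 1:]" q] by simp
  have q0: "coeff q (Suc ?N) = 0" by (simp add: coeff_eq_0)
  have "poly_apply M ([:- a, 1:] * q) z =
      (\<Sum>i\<le>Suc ?N. coeff ([:- a, 1:] * q) i *s ?f i)"
    by (rule poly_apply_eq [OF deg])
  also have "\<dots> = (\<Sum>i\<le>Suc ?N. (- a * coeff q i) *s ?f i) +
      (\<Sum>i\<le>Suc ?N. (case i of 0 \<Rightarrow> 0 | Suc j \<Rightarrow> coeff q j) *s ?f i)"
    by (simp add: coeff_pCons sum.distrib [symmetric] vector_sadd_rdistrib del: sum.atMost_Suc)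
  also have "(\<Sum>i\<le>Suc ?N. (- a * coeff q i) *s ?f i) = (\<Sum>i\<le>?N. (- a * coeff q i) *s ?f i)"
    by (simp add: q0)
  also have "(\<Sum>i\<le>Suc ?N. (case i of 0 \<Rightarrow> 0 | Suc j \<Rightarrow> coeff q j) *s ?f i) =
      (\<Sum>i\<le>?N. coeff q i *s ?f (Suc i))"
    by (subst sum.atMost_Suc_shift) simp
  also have "(\<Sum>i\<le>?N. (- a * coeff q i) *s ?f i) + (\<Sum>i\<le>?N. coeff q i *s ?f (Suc i)) =
      poly_apply M q (M *v z - a *s z)"
    unfolding poly_apply_def funpow_matrix_diff_scale sum.distrib [symmetric]
    by (intro sum.cong refl) (simp add: vec_eq_iff algebra_simps)
  finally show "poly_apply M ([:- a, 1:] * q) z = poly_apply M q (M *v z - a *s z)" .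
  show "poly_apply M q (M *v z - a *s z) = M *v poly_apply M q z - a *s poly_apply M q z"
    unfolding poly_apply_def funpow_matrix_diff_scale vec.sum vec.scale_sum_right sum_subtractf [symmetric]
    by (intro sum.cong refl) (simp add: vec_eq_iff vector_scalar_commute algebra_simps)
qed

lemma annihilating_polynomial:
  fixes M :: "complex^'n^'n"
  obtains p where "p \<noteq> 0" "poly_apply M p z = 0"
proof -
  define f where "f i = ((*v) M ^^ i) z" for i
  let ?n = "CARD('n)"
  have "\<exists>c. (\<exists>i\<le>?n. c i \<noteq> 0) \<and> (\<Sum>i\<le>?n. c i *s f i) = 0"
  \<comment> \<open>Dependence is a property of sets, so a repetition in the orbit is treated apart;
    it yields the relation f i - f j = 0.\<close>
  proof (cases "inj_on f {..?n}")
    case True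
    then have "card (f ` {..?n}) = Suc ?n" by (simp add: card_image)
    then have "vec.dependent (f ` {..?n})"
      using vec.independent_card_le_dim [of "f ` {..?n}" UNIV] by (auto simp: card_cart_basis)
    then obtain u where "\<exists>v\<in>f ` {..?n}. u v \<noteq> 0" "(\<Sum>v\<in>f ` {..?n}. u v *s v) = 0"
      by (auto simp: vec.dependent_finite)
    then show ?thesis
      by (intro exI [of _ "u \<circ> f"]) (auto simp: sum.reindex [OF True])
  next
    case False
    then obtain i j where ij: "i \<le> ?n" "j \<le> ?n" "i \<noteq> j" "f i = f j"
      by (auto simp: inj_on_def)
    have "(\<Sum>k\<le>?n. ((if k = i then 1 else 0) - (if k = j then 1 else 0)) *s f k) =
        (\<Sum>k\<le>?n. if k = i then f i else 0) - (\<Sum>k\<le>?n. if k = j then f j else 0)"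
      unfolding sum_subtractf [symmetric] by (intro sum.cong) (auto simp: vector_sub_rdistrib)
    also have "\<dots> = 0" using ij by simp
    finally show ?thesis using ij
      by (intro exI [of _ "\<lambda>k. (if k = i then 1 else 0) - (if k = j then 1 else 0)"]) auto
  qed
  then obtain c i where c: "i \<le> ?n" "c i \<noteq> 0" "(\<Sum>i\<le>?n. c i *s f i) = 0" by blast
  define p where "p = (\<Sum>i\<le>?n. monom (c i) i)"
  have p: "coeff p k = (if k \<le> ?n then c k else 0)" for k
    by (simp add: p_def coeff_sum)
  have "degree p \<le> ?n" by (rule degree_le) (simp add: p)
  then have "poly_apply M p z = (\<Sum>i\<le>?n. c i *s f i)"
    by (simp add: poly_apply_eq p f_def)
  moreover have "p \<noteq> 0" using c p [of i] by auto
  ultimately show thesis using that c by simp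
qed

text \<open>A substitute for the decomposition into generalised eigenspaces. Induct on the degree of
  a polynomial that annihilates \<open>z\<close> and split off a root \<open>a\<close>. If
  \<open>a\<close> is an eigenvalue, the quotient annihilates M z - a z, and \<open>step\<close>
  applies; if not, M - a is injective and the quotient already annihilates \<open>z\<close>.\<close>

lemma generalized_eigenvector_induct:
  fixes M :: "complex^'n^'n"
  assumes zero: "0 \<in> W"
    and step: "\<And>a e z. e \<noteq> 0 \<Longrightarrow> M *v e = a *s e \<Longrightarrow> M *v z - a *s z \<in> W \<Longrightarrow> z \<in> W"
  shows "z \<in> W"
proof -
  have "z \<in> W" if "degree p = d" "p \<noteq> 0" "poly_apply M p z = 0" for d p z
    using that
  proof (induction d arbitrary: p z)
    case 0
    then obtain c where "p = [:c:]" by (metis degree_eq_zeroE)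
    with 0 have "c \<noteq> 0" "c *s z = 0" by (auto simp: poly_apply_def)
    then show ?case using zero by simp
  next
    case (Suc d)
    then have "\<not> constant (poly p)" by (simp add: constant_degree)
    then obtain a where "poly p a = 0" using fundamental_theorem_of_algebra by blast
    then obtain q where q: "p = [:- a, 1:] * q" by (metis poly_eq_0_iff_dvd dvdE)
    with Suc have "q \<noteq> 0" by auto
    then have "degree q = d" using Suc q by (simp add: degree_mult_eq del: mult_pCons_left)
    show ?case
    proof (cases "\<exists>e. e \<noteq> 0 \<and> M *v e = a *s e")
      case True
      moreover have "M *v z - a *s z \<in> W"
        using Suc.IH [OF \<open>degree q = d\<close> \<open>q \<noteq> 0\<close>] Suc.prems
        by (simp add: q poly_apply_linear_factor(1) del: mult_pCons_left)
      ultimately show ?thesis using step by blast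
    next
      case False
      have "M *v poly_apply M q z = a *s poly_apply M q z"
        using Suc.prems by (simp add: q poly_apply_linear_factor del: mult_pCons_left)
      with False have "poly_apply M q z = 0" by blast
      then show ?thesis
        using Suc.IH [OF \<open>degree q = d\<close> \<open>q \<noteq> 0\<close>] by blast
    qed
  qed
  with annihilating_polynomial show ?thesis by metis
qed

lemma mat_mult_vector: "mat a *v x = a *s (x :: 'a::comm_semiring_1^'n)"
  by (simp add: matrix_vector_mult_def mat_def vec_eq_iff if_distrib [of "\<lambda>x. x * _"] cong: if_cong)

lemma vector_mult_mat: "x v* mat a = a *s (x :: 'a::comm_semiring_1^'n)"
  by (metis mat_mult_vector transpose_mat transpose_matrix_vector)

lemma left_eigenvector_exists:
  fixes M :: "'a::field^'n^'n"
  assumes "e \<noteq> 0" "M *v e = a *s e"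
  obtains p where "p \<noteq> 0" "p v* M = a *s p"
proof -
  have "(M - mat a) *v e = 0"
    using assms by (simp add: matrix_vector_mult_diff_rdistrib mat_mult_vector)
  then have "\<not> (\<exists>B. B ** (M - mat a) = mat 1)"
    using assms matrix_left_invertible_ker by blast
  then have "\<not> (\<exists>B. B ** transpose (M - mat a) = mat 1)"
    by (simp add: left_invertible_transpose matrix_left_right_inverse)
  then obtain p where "p \<noteq> 0" "transpose (M - mat a) *v p = 0"
    using matrix_left_invertible_ker by blast
  then show thesis
    using that by (simp add: vector_matrix_mult_diff_rdistrib vector_mult_mat)
qed

text \<open>A nonzero coordinate of \<open>p\<close> expresses one row through the others, so the
  row rank drops below the number of rows.\<close>

lemma full_row_rank_left_kernel:
  fixes A :: "'a::field^'n^'m"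
  assumes rank: "rank A = CARD('m)" and p: "p v* A = 0"
  shows "p = 0"
proof (rule ccontr)
  assume "p \<noteq> 0"
  then obtain i where i: "p $ i \<noteq> 0" by (auto simp: vec_eq_iff)
  let ?S = "(\<lambda>j. row j A) ` (UNIV - {i})"
  have "(\<Sum>j\<in>UNIV. p $ j *s row j A) = 0"
    using p by (simp add: vec_eq_iff vector_matrix_mult_def row_def mult.commute)
  then have "p $ i *s row i A = - (\<Sum>j\<in>UNIV - {i}. p $ j *s row j A)"
    by (simp add: sum.remove [of UNIV i] eq_neg_iff_add_eq_0)
  also have "\<dots> \<in> vec.span ?S"
    by (intro vec.span_neg vec.span_sum vec.span_scale vec.span_base) auto
  finally have "inverse (p $ i) *s (p $ i *s row i A) \<in> vec.span ?S"
    by (rule vec.span_scale)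
  then have row_i: "row i A \<in> vec.span ?S" using i by simp
  have "rows A \<subseteq> vec.span ?S"
  proof -
    have "row j A \<in> vec.span ?S" for j
      using row_i by (cases "j = i") (auto intro: vec.span_base)
    then show ?thesis by (auto simp: rows_def)
  qed
  then have "vec.dim (rows A) \<le> card ?S"
    by (intro vec.span_card_ge_dim) (auto simp: rows_def)
  also have "\<dots> \<le> card (UNIV - {i})" by (rule card_image_le) auto
  also have "\<dots> < CARD('m)" by (intro psubset_card_mono) auto
  finally show False using rank by (simp add: row_rank_def_gen)
qed

text \<open>The preimage is the orthogonal complement of the image of
  \<open>L\<^sup>\<bottom>\<close> under \<open>transpose F\<close>, and a linear image does not
  exceed its source in dimension.\<close>

lemma dim_preimage_ge:
  fixes F :: "real^'n^'n"
  assumes "subspace L"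
  shows "dim L \<le> dim {x. F *v x \<in> L}"
proof -
  have dimc: "dim (V\<^sup>\<bottom>) + dim V = CARD('n)" if "subspace V" for V :: "(real^'n) set"
    using dim_subspace_orthogonal_to_vectors [OF that subspace_UNIV] by (simp add: orthogonal_comp_def)
  let ?V = "(*v) (transpose F) ` (L\<^sup>\<bottom>)"
  have V: "subspace ?V" by (intro linear_subspace_image subspace_orthogonal_comp) auto
  have "{x. F *v x \<in> L} = ?V\<^sup>\<bottom>"
  proof -
    have "F *v x \<in> L \<longleftrightarrow> F *v x \<in> L\<^sup>\<bottom>\<^sup>\<bottom>" for x
      using orthogonal_comp_self [OF assms] by simp
    then show ?thesis
      by (auto simp: orthogonal_comp_def orthogonal_def dot_lmul_matrix)
  qed
  then have "dim {x. F *v x \<in> L} + dim ?V = CARD('n)"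
    using dimc [OF V] by simp
  moreover have "dim ?V \<le> dim (L\<^sup>\<bottom>)" by (rule dim_image_le) auto
  ultimately show ?thesis using dimc [OF assms] by simp
qed

text \<open>\<open>P\<close> stands for the passage to the quotient by \<open>W\<close>: it kills a
  basis of \<open>W\<close> and fixes the vectors completing it. The map induced by F on the
  quotient is then studied as the matrix P F.\<close>

lemma projection_matrix_exists:
  fixes W :: "(real^'n) set"
  assumes "subspace W"
  obtains P :: "real^'n^'n" where "\<And>x. P *v x - x \<in> W" "\<And>w. w \<in> W \<Longrightarrow> P *v w = 0"
proof -
  obtain B where B: "B \<subseteq> W" "independent B" "W \<subseteq> span B"
    using basis_exists by metis
  obtain D where D: "B \<subseteq> D" "independent D" "UNIV \<subseteq> span D"
    using maximal_independent_subset_extend [of B UNIV] B by auto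
  obtain g where g: "linear g" "\<And>x. x \<in> D \<Longrightarrow> g x = (if x \<in> B then 0 else x)"
    using linear_independent_extend [OF D(2), of "\<lambda>x. if x \<in> B then 0 else x"] by blast
  interpret g: linear g by fact
  have "g x - x \<in> W" for x
  proof -
    have "x \<in> span D" using D by auto
    then show ?thesis
    proof (induction rule: span_induct)
      case base
      show ?case
        unfolding subspace_def using assms
        by (auto simp: g.zero g.add g.scale subspace_0 algebra_simps
            intro: subspace_add subspace_mul simp flip: scaleR_diff_right add_diff_add)
          (metis add_diff_add subspace_add)
    next
      case (step x)
      then show ?case
        using g(2) B assms by (auto intro: subspace_neg simp: subspace_0)
    qed
  qed
  moreover have "g w = 0" if "w \<in> W" for w
  proof -
    have "w \<in> span B" using that B by auto
    then show ?thesis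
      by (rule linear_eq_0_on_span [OF g(1), rotated]) (use g(2) D B in auto)
  qed
  ultimately show thesis
    using that [of "matrix g"] g(1) by simp
qed

section \<open>Complex vectors as pairs of real ones, and quadratic forms on them\<close>

abbreviation complex_mat :: "real^'n^'m \<Rightarrow> complex^'n^'m" where
  "complex_mat M \<equiv> map_matrix complex_of_real M"

definition Re_vec :: "complex^'n \<Rightarrow> real^'n" where "Re_vec z = (\<chi> i. Re (z $ i))"
definition Im_vec :: "complex^'n \<Rightarrow> real^'n" where "Im_vec z = (\<chi> i. Im (z $ i))"

lemma complex_vec_eqI: "Re_vec z = Re_vec z' \<Longrightarrow> Im_vec z = Im_vec z' \<Longrightarrow> z = z'"
  by (simp add: Re_vec_def Im_vec_def vec_eq_iff complex_eq_iff)

lemma Re_Im_vec_simps [simp]: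
  "Re_vec 0 = 0" "Im_vec 0 = 0"
  "Re_vec (z + z') = Re_vec z + Re_vec z'" "Im_vec (z + z') = Im_vec z + Im_vec z'"
  "Re_vec (z - z') = Re_vec z - Re_vec z'" "Im_vec (z - z') = Im_vec z - Im_vec z'"
  "Re_vec (a *s z) = Re a *\<^sub>R Re_vec z - Im a *\<^sub>R Im_vec z"
  "Im_vec (a *s z) = Re a *\<^sub>R Im_vec z + Im a *\<^sub>R Re_vec z"
  "Re_vec (complex_mat M *v z) = M *v Re_vec z" "Im_vec (complex_mat M *v z) = M *v Im_vec z"
  "Re_vec (p v* complex_mat N) = Re_vec p v* N" "Im_vec (p v* complex_mat N) = Im_vec p v* N"
  by (simp_all add: Re_vec_def Im_vec_def vec_eq_iff matrix_vector_mult_def vector_matrix_mult_def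
      Re_sum Im_sum)

text \<open>Nonnegativity of the form at \<open>\<epsilon> *\<^sub>R x - y\<close>, divided by
  \<open>\<epsilon>\<close>. A small \<open>\<epsilon>\<close> keeps the factor of the
  \<open>x\<close> term close to 1, as the contraction argument requires.\<close>

lemma psd_form_weighted_triangle:
  assumes M: "psd_mat M" and "\<epsilon> > 0"
  shows "(x + y) \<bullet> (M *v (x + y)) \<le> (1 + \<epsilon>) * (x \<bullet> (M *v x)) + (1 + 1 / \<epsilon>) * (y \<bullet> (M *v y))"
proof -
  have xy: "y \<bullet> (M *v x) = x \<bullet> (M *v y)"
    using M symmetric_mat_inner [of M x y] by (simp add: psd_mat_def inner_commute)
  have "0 \<le> (\<epsilon> *\<^sub>R x - y) \<bullet> (M *v (\<epsilon> *\<^sub>R x - y)) / \<epsilon>"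
    using M \<open>\<epsilon> > 0\<close> by (simp add: psd_mat_def)
  also have "\<dots> = \<epsilon> * (x \<bullet> (M *v x)) - 2 * (x \<bullet> (M *v y)) + (1 / \<epsilon>) * (y \<bullet> (M *v y))"
    using \<open>\<epsilon> > 0\<close>
    by (simp add: matrix_vector_mult_diff_distrib matrix_vector_mult_scaleR inner_diff_left
        inner_diff_right xy field_simps)
  finally show ?thesis
    by (simp add: matrix_vector_right_distrib inner_add_left inner_add_right xy algebra_simps)
qed

text \<open>The sum over real and imaginary part is the Hermitian form of the real symmetric
  \<open>M\<close>, and the cross terms of a complex scaling cancel in it.\<close>

lemma psd_form_complex_scale:
  assumes "psd_mat M"
  shows "Re_vec (a *s z) \<bullet> (M *v Re_vec (a *s z)) + Im_vec (a *s z) \<bullet> (M *v Im_vec (a *s z)) =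
    (cmod a)\<^sup>2 * (Re_vec z \<bullet> (M *v Re_vec z) + Im_vec z \<bullet> (M *v Im_vec z))"
proof -
  have xy: "y \<bullet> (M *v x) = x \<bullet> (M *v y)" for x y
    using assms symmetric_mat_inner [of M x y] by (simp add: psd_mat_def inner_commute)
  show ?thesis
    unfolding cmod_power2 using xy [of "Im_vec z" "Re_vec z"]
    by (simp add: matrix_vector_mult_diff_distrib matrix_vector_right_distrib
        matrix_vector_mult_scaleR inner_diff_left inner_diff_right inner_add_left inner_add_right
        power2_eq_square algebra_simps)
qed

text \<open>The bound is the fixed point of s -> c + \<rho> s.\<close>

lemma affine_recursion_bounded:
  fixes Q :: "nat \<Rightarrow> real"
  assumes "0 \<le> \<rho>" "\<rho> < 1" "\<And>k. Q (Suc k) \<le> c + \<rho> * Q k" "Q 0 \<le> c / (1 - \<rho>)"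
  shows "Q k \<le> c / (1 - \<rho>)"
proof (induction k)
  case (Suc k)
  have "Q (Suc k) \<le> c + \<rho> * Q k" by (rule assms(3))
  also have "\<dots> \<le> c + \<rho> * (c / (1 - \<rho>))" using mult_left_mono [OF Suc.IH assms(1)] by simp
  also have "\<dots> = c / (1 - \<rho>)" using assms by (simp add: field_simps)
  finally show ?case .
qed (use assms in simp)

text \<open>The control problem in abstract form: the form of \<open>G k\<close> is the optimal cost
  of k periods, \<open>F\<close> the uncontrolled period map, \<open>K\<close> the corrections that
  a control can add within a period. \<open>step\<close> bounds the cost of a period with a given
  correction independently of k, and \<open>hautus\<close> is the rank condition in dual
  form.\<close>

lemma psd_sequence_bounded:
  fixes F :: "real^'n^'n" and G :: "nat \<Rightarrow> real^'n^'n"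
  assumes K: "subspace K" and psd: "\<And>k. psd_mat (G k)" and G0: "G 0 = 0"
    and step: "\<And>x w. w \<in> K \<Longrightarrow>
      \<exists>c. \<forall>k. x \<bullet> (G (Suc k) *v x) \<le> c + (F *v x + w) \<bullet> (G k *v (F *v x + w))"
    and hautus: "\<And>a p. 1 \<le> cmod a \<Longrightarrow> p v* complex_mat F = a *s p \<Longrightarrow>
      (\<And>w. w \<in> K \<Longrightarrow> Re_vec p \<bullet> w = 0 \<and> Im_vec p \<bullet> w = 0) \<Longrightarrow> p = 0"
  shows "\<exists>c. \<forall>k. x \<bullet> (G k *v x) \<le> c"
proof -
  define q where "q k x = x \<bullet> (G k *v x)" for k x
  define W where "W = {x. \<exists>c. \<forall>k. q k x \<le> c}"
  have q0: "q 0 x = 0" for x by (simp add: q_def G0)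
  have qtri: "q k (x + y) \<le> (1 + \<epsilon>) * q k x + (1 + 1 / \<epsilon>) * q k y" if "\<epsilon> > 0" for \<epsilon> k x y
    unfolding q_def by (rule psd_form_weighted_triangle [OF psd that])
  have W: "subspace W"
    unfolding subspace_def
  proof (intro conjI ballI allI)
    show "0 \<in> W" by (auto simp: W_def q_def)
    show "x + y \<in> W" if xy: "x \<in> W" "y \<in> W" for x y
    proof -
      from xy obtain c d where cd: "\<And>k. q k x \<le> c" "\<And>k. q k y \<le> d" unfolding W_def by blast
      have "q k (x + y) \<le> 2 * c + 2 * d" for k
        using qtri [of 1 k x y] cd [of k] by simp
      then show ?thesis unfolding W_def by blast
    qed
    show "a *\<^sub>R x \<in> W" if x: "x \<in> W" for a x
    proof -
      from x obtain c where c: "\<And>k. q k x \<le> c" unfolding W_def by blast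
      have "q k (a *\<^sub>R x) \<le> a * a * c" for k
        using c [of k] by (simp add: q_def matrix_vector_mult_scaleR mult_left_mono mult.assoc [symmetric])
      then show ?thesis unfolding W_def by blast
    qed
  qed
  \<comment> \<open>A state that can be brought into \<open>W\<close> within one period has bounded
    cost itself. The maximum with 0 accounts for k = 0, where the form vanishes.\<close>
  have back_step: "x \<in> W" if w: "w \<in> K" and Fx: "F *v x + w \<in> W" for x w
  proof -
    obtain c where c: "\<And>k. q (Suc k) x \<le> c + q k (F *v x + w)"
      using step [OF w, of x] unfolding q_def by blast
    obtain d where "\<And>k. q k (F *v x + w) \<le> d" using Fx unfolding W_def by blast
    with c have "q (Suc k) x \<le> c + d" for k by (meson add_left_mono order_trans)
    then have "q k x \<le> max 0 (c + d)" for k by (cases k) (auto simp: q0 max.coboundedI2)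
    then show ?thesis unfolding W_def by blast
  qed
  define L where "L = {x + w | x w. x \<in> W \<and> w \<in> K}"
  have L: "subspace L" unfolding L_def by (rule subspace_sums [OF W K])
  have KL: "K \<subseteq> L" and WL: "W \<subseteq> L"
    using subspace_0 [OF W] subspace_0 [OF K] by (force simp: L_def)+
  have pre: "{x. F *v x \<in> L} \<subseteq> W"
  proof
    fix x assume "x \<in> {x. F *v x \<in> L}"
    then obtain y w where "F *v x = y + w" "y \<in> W" "w \<in> K" by (auto simp: L_def)
    then show "x \<in> W" using back_step [of "- w" x] K by (simp add: subspace_neg)
  qed
  \<comment> \<open>With \<open>WL\<close> this closes the chain dim W <= dim L <= dim of the
    preimage <= dim W.\<close>
  have dims: "dim L \<le> dim {x. F *v x \<in> L}" "dim {x. F *v x \<in> L} \<le> dim W"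
    using dim_preimage_ge [OF L] dim_subset [OF pre] by auto
  then have LW: "L = W"
    using subspace_dim_equal [OF W L WL] by simp
  have preL: "subspace {x. F *v x \<in> L}"
    using L by (auto simp: subspace_def matrix_vector_right_distrib matrix_vector_mult_scaleR)
  have "{x. F *v x \<in> L} = W"
    using subspace_dim_equal [OF preL W pre] dims LW by simp
  then have FW: "F *v x \<in> W" if "x \<in> W" for x using that LW by blast
  have KW: "K \<subseteq> W" using KL LW by simp
  obtain P where P: "\<And>x. P *v x - x \<in> W" "\<And>w. w \<in> W \<Longrightarrow> P *v w = 0"
    using projection_matrix_exists [OF W] by blast
  let ?M = "complex_mat (P ** F)" and ?W = "{z. Re_vec z \<in> W \<and> Im_vec z \<in> W}"
  have "z \<in> ?W" for z
  proof (rule generalized_eigenvector_induct [where M = ?M])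
    show "0 \<in> ?W" using subspace_0 [OF W] by simp
    fix a e z assume e: "e \<noteq> 0" "?M *v e = a *s e" and z: "?M *v z - a *s z \<in> ?W"
    \<comment> \<open>Suppose |a| >= 1. A left eigenvector \<open>p\<close> of P F annihilates W,
      because P F does so and \<open>a\<close> is nonzero. Since P differs from the identity by
      vectors of W, \<open>p\<close> is a left eigenvector of F itself, and it annihilates
      K.\<close>
    have a: "cmod a < 1"
    proof (rule ccontr)
      assume "\<not> cmod a < 1"
      then have a1: "1 \<le> cmod a" by simp
      obtain p where p: "p \<noteq> 0" "p v* ?M = a *s p"
        using left_eigenvector_exists [OF e] by blast
      have pRe: "Re_vec p v* (P ** F) = Re a *\<^sub>R Re_vec p - Im a *\<^sub>R Im_vec p"
        and pIm: "Im_vec p v* (P ** F) = Re a *\<^sub>R Im_vec p + Im a *\<^sub>R Re_vec p"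
        using arg_cong [OF p(2), of Re_vec] arg_cong [OF p(2), of Im_vec] by simp_all
      have orth: "Re_vec p \<bullet> w = 0 \<and> Im_vec p \<bullet> w = 0" if "w \<in> W" for w
      proof -
        have "P *v (F *v w) = 0" using P FW that by blast
        then have "(u v* (P ** F)) \<bullet> w = 0" for u
          by (simp add: dot_lmul_matrix flip: matrix_vector_mul_assoc)
        then have 1: "Re a * (Re_vec p \<bullet> w) - Im a * (Im_vec p \<bullet> w) = 0"
          and 2: "Re a * (Im_vec p \<bullet> w) + Im a * (Re_vec p \<bullet> w) = 0"
          using arg_cong [OF pRe, of "\<lambda>u. u \<bullet> w"] arg_cong [OF pIm, of "\<lambda>u. u \<bullet> w"]
          by (simp_all add: inner_diff_left inner_add_left)
        have "a * Complex (Re_vec p \<bullet> w) (Im_vec p \<bullet> w) = 0"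
          using 1 2 by (simp add: complex_eq_iff)
        moreover have "a \<noteq> 0" using a1 by auto
        ultimately have "Complex (Re_vec p \<bullet> w) (Im_vec p \<bullet> w) = 0"
          by (metis mult_eq_0_iff)
        then show ?thesis by (simp add: complex_eq_iff)
      qed
      have PF: "u v* (P ** F) = u v* F" if u: "\<And>w. w \<in> W \<Longrightarrow> u \<bullet> w = 0" for u
      proof -
        have "(u v* (P ** F)) \<bullet> x = (u v* F) \<bullet> x" for x
          using u [OF P(1), of "F *v x"]
          by (simp add: dot_lmul_matrix inner_diff_right flip: matrix_vector_mul_assoc)
        then show ?thesis using vector_eq_rdot by blast
      qed
      have "p v* complex_mat F = a *s p"
        by (rule complex_vec_eqI) (use pRe pIm PF [of "Re_vec p"] PF [of "Im_vec p"] orth in simp_all)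
      then show False
        using hautus [OF a1] orth KW p(1) by blast
    qed
    \<comment> \<open>Modulo W there is no difference between F z and P F z, so F z = a z + v with
      both parts of \<open>v\<close> in W.\<close>
    define v where "v = complex_mat F *v z - a *s z"
    have v: "Re_vec v \<in> W" "Im_vec v \<in> W"
    proof -
      have "Re_vec v = Re_vec (?M *v z - a *s z) - (P *v (F *v Re_vec z) - F *v Re_vec z)"
        "Im_vec v = Im_vec (?M *v z - a *s z) - (P *v (F *v Im_vec z) - F *v Im_vec z)"
        by (simp_all add: v_def matrix_vector_mul_assoc)
      then show "Re_vec v \<in> W" "Im_vec v \<in> W"
        using z P(1) subspace_diff [OF W] by auto
    qed
    have Fz: "F *v Re_vec z = Re_vec (a *s z) + Re_vec v" "F *v Im_vec z = Im_vec (a *s z) + Im_vec v"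
      by (simp_all add: v_def)
    have "\<exists>c. \<forall>k. q (Suc k) x \<le> c + q k (F *v x)" for x
      using step [OF subspace_0 [OF K], of x] unfolding q_def by simp
    then obtain c1 c2 where c: "\<And>k. q (Suc k) (Re_vec z) \<le> c1 + q k (F *v Re_vec z)"
        "\<And>k. q (Suc k) (Im_vec z) \<le> c2 + q k (F *v Im_vec z)"
      by meson
    obtain d1 d2 where d: "\<And>k. q k (Re_vec v) \<le> d1" "\<And>k. q k (Im_vec v) \<le> d2"
      using v unfolding W_def by blast
    define l where "l = (cmod a)\<^sup>2"
    have l: "0 \<le> l" "l < 1" using a by (auto simp: l_def power_less_one_iff abs_square_less_1)
    \<comment> \<open>Any \<open>\<epsilon>\<close> with (1 + \<epsilon>) l < 1 would do; for this
      one the inequality amounts to (1 - l)(2 - l) > 0.\<close>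
    define \<epsilon> where "\<epsilon> = (1 - l) / 2"
    have \<epsilon>: "\<epsilon> > 0" using l by (simp add: \<epsilon>_def)
    define \<rho> where "\<rho> = (1 + \<epsilon>) * l"
    have "0 < (1 - l) * (2 - l)" using l by simp
    then have "\<rho> < 1" by (simp add: \<rho>_def \<epsilon>_def field_simps)
    moreover have "0 \<le> \<rho>" using l \<epsilon> by (simp add: \<rho>_def)
    ultimately have \<rho>: "0 \<le> \<rho>" "\<rho> < 1" by auto
    define Q where "Q k = q k (Re_vec z) + q k (Im_vec z)" for k
    define c' where "c' = c1 + c2 + (1 + 1 / \<epsilon>) * (d1 + d2)"
    have Qstep: "Q (Suc k) \<le> c' + \<rho> * Q k" for k
    proof -
      have "q k (F *v Re_vec z) + q k (F *v Im_vec z) \<le>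
          (1 + \<epsilon>) * (q k (Re_vec (a *s z)) + q k (Im_vec (a *s z))) +
          (1 + 1 / \<epsilon>) * (q k (Re_vec v) + q k (Im_vec v))"
        unfolding Fz using qtri [OF \<epsilon>, of k "Re_vec (a *s z)" "Re_vec v"]
          qtri [OF \<epsilon>, of k "Im_vec (a *s z)" "Im_vec v"] by (simp add: distrib_left)
      also have "q k (Re_vec (a *s z)) + q k (Im_vec (a *s z)) = l * Q k"
        unfolding q_def Q_def l_def by (rule psd_form_complex_scale [OF psd])
      also have "(1 + 1 / \<epsilon>) * (q k (Re_vec v) + q k (Im_vec v)) \<le> (1 + 1 / \<epsilon>) * (d1 + d2)"
        using \<epsilon> d by (intro mult_left_mono add_mono) auto
      finally have "q k (F *v Re_vec z) + q k (F *v Im_vec z) \<le>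
          (1 + \<epsilon>) * (l * Q k) + (1 + 1 / \<epsilon>) * (d1 + d2)"
        by simp
      moreover have "(1 + \<epsilon>) * (l * Q k) = \<rho> * Q k" by (simp only: \<rho>_def mult.assoc)
      moreover have "Q (Suc k) = q (Suc k) (Re_vec z) + q (Suc k) (Im_vec z)" by (simp only: Q_def)
      ultimately show ?thesis
        using c(1) [of k] c(2) [of k] unfolding c'_def by linarith
    qed
    \<comment> \<open>Together with Q 0 = 0 this forces c' >= 0, which is the start of the affine
      recursion.\<close>
    have "0 \<le> Q 1"
      using psd by (auto simp: Q_def q_def psd_mat_def)
    then have c'0: "0 \<le> c'" using Qstep [of 0] by (simp add: Q_def q0)
    have "Q k \<le> c' / (1 - \<rho>)" for k
      by (rule affine_recursion_bounded [where Q = Q, OF \<rho> Qstep]) (use \<rho> c'0 in \<open>simp add: Q_def q0\<close>)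
    then have Qb: "q k (Re_vec z) + q k (Im_vec z) \<le> c' / (1 - \<rho>)" for k
      unfolding Q_def .
    have q_nonneg: "0 \<le> q k x" for k x using psd by (simp add: q_def psd_mat_def)
    have "q k (Re_vec z) \<le> c' / (1 - \<rho>)" "q k (Im_vec z) \<le> c' / (1 - \<rho>)" for k
      using Qb [of k] q_nonneg [of k "Re_vec z"] q_nonneg [of k "Im_vec z"] by linarith+
    then show "z \<in> ?W" unfolding W_def by blast
  qed
  from this [of "\<chi> i. complex_of_real (x $ i)"] have "x \<in> W"
    by (simp add: Re_vec_def)
  then show ?thesis by (simp add: W_def q_def)
qed

section \<open>Reachability and solvability of the algebraic equation\<close>

text \<open>Motions of the original plant, with the matrix \<open>A\<close> of the rank condition;
  \<open>plant_trajectory_bound\<close> transfers them to \<open>At\<close>.\<close>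

definition plant_trajectory ::
  "real \<Rightarrow> real^'n^'n \<Rightarrow> real^'m^'n \<Rightarrow> (real \<Rightarrow> real^'n) \<Rightarrow> (real \<Rightarrow> real^'m) \<Rightarrow> bool" where
  "plant_trajectory \<kappa> A B \<xi> u \<longleftrightarrow> continuous_on {0..\<kappa>} u \<and>
    (\<forall>t\<in>{0..\<kappa>}. (\<xi> has_vector_derivative (A *v \<xi> t + B *v u t)) (at t within {0..\<kappa>}))"

definition reachable_set :: "real \<Rightarrow> real^'n^'n \<Rightarrow> real^'m^'n \<Rightarrow> (real^'n) set" where
  "reachable_set \<kappa> A B = {\<xi> \<kappa> | \<xi> u. plant_trajectory \<kappa> A B \<xi> u \<and> \<xi> 0 = 0}"

lemma plant_trajectory_add:
  assumes "plant_trajectory \<kappa> A B \<xi> u" "plant_trajectory \<kappa> A B \<xi>' u'"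
  shows "plant_trajectory \<kappa> A B (\<lambda>t. \<xi> t + \<xi>' t) (\<lambda>t. u t + u' t)"
  using assms unfolding plant_trajectory_def
  by (auto intro!: continuous_intros derivative_eq_intros simp: matrix_vector_right_distrib)

lemma plant_trajectory_scale:
  assumes "plant_trajectory \<kappa> A B \<xi> u"
  shows "plant_trajectory \<kappa> A B (\<lambda>t. c *\<^sub>R \<xi> t) (\<lambda>t. c *\<^sub>R u t)"
  using assms unfolding plant_trajectory_def
  by (auto intro!: continuous_intros derivative_eq_intros
      simp: matrix_vector_mult_scaleR scaleR_add_right)

lemma plant_trajectory_free: "plant_trajectory \<kappa> A B (\<lambda>t. mat_exp (t *\<^sub>R A) *v x) (\<lambda>_. 0)"
  unfolding plant_trajectory_def
  using has_vector_derivative_matrix_vector_mult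
    [OF mat_exp_has_vector_derivative_within has_vector_derivative_const [of x]]
  by (simp add: matrix_vector_mul_assoc)

lemma subspace_reachable_set: "subspace (reachable_set \<kappa> A B)"
  unfolding subspace_def
proof (intro conjI ballI allI)
  show "0 \<in> reachable_set \<kappa> A B"
    using plant_trajectory_free [of \<kappa> A B 0] by (force simp: reachable_set_def)
  fix x assume "x \<in> reachable_set \<kappa> A B"
  then obtain \<xi> u where x: "plant_trajectory \<kappa> A B \<xi> u" "\<xi> 0 = 0" "x = \<xi> \<kappa>"
    by (auto simp: reachable_set_def)
  show "c *\<^sub>R x \<in> reachable_set \<kappa> A B" for c
    using plant_trajectory_scale [OF x(1), of c] x unfolding reachable_set_def by force
  fix y assume "y \<in> reachable_set \<kappa> A B"
  then obtain \<xi>' u' where y: "plant_trajectory \<kappa> A B \<xi>' u'" "\<xi>' 0 = 0" "y = \<xi>' \<kappa>"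
    by (auto simp: reachable_set_def)
  show "x + y \<in> reachable_set \<kappa> A B"
    using plant_trajectory_add [OF x(1) y(1)] x y unfolding reachable_set_def by force
qed

lemma fundamental_matrix_mat_exp:
  "fundamental_matrix \<kappa> (\<lambda>_. A) (\<lambda>t s. mat_exp ((t - s) *\<^sub>R A))"
  unfolding fundamental_matrix_def
  using mat_exp_affine_has_vector_derivative_within [of "- s" 1 A for s] by simp

lemma plant_trajectory_exists:
  assumes u: "continuous_on {0..\<kappa>} u" and "\<kappa> > 0"
  obtains \<xi> where "plant_trajectory \<kappa> A B \<xi> u" "\<xi> 0 = x"
proof -
  have "continuous_on {0..\<kappa>} (\<lambda>t. - (B *v u t))"
    by (intro continuous_intros continuous_on_matrix_vector_mult u)
  from inhomogeneous_ode_exists [OF fundamental_matrix_mat_exp continuous_on_const this \<open>\<kappa> > 0\<close>]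
  show thesis using that u unfolding plant_trajectory_def by (metis diff_minus_eq_add)
qed

text \<open>The control \<open>u(t) = p e\<^sup>A\<^sup>(\<^sup>\<kappa>\<^sup>-\<^sup>t\<^sup>) B\<close> has energy \<open>p \<bullet> \<xi>(\<kappa>) = 0\<close>, so it vanishes
  identically, and so do its derivatives.\<close>

lemma reachable_set_normal:
  fixes A :: "real^'n^'n" and B :: "real^'m^'n"
  assumes "\<kappa> > 0" and p: "\<And>w. w \<in> reachable_set \<kappa> A B \<Longrightarrow> p \<bullet> w = 0"
  shows "p v* (mat_exp (\<kappa> *\<^sub>R A) ** (mat_power A j ** B)) = 0"
proof -
  define E where "E t = mat_exp ((\<kappa> - t) *\<^sub>R A)" for t
  have dE: "(E has_vector_derivative - (E t ** A)) (at t within s)" for t s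
    using mat_exp_affine_has_vector_derivative_within [of \<kappa> "-1" A]
      mat_exp_scaleR_commute [of "\<kappa> - t" A] by (simp add: E_def [abs_def])
  have lin: "bounded_linear (\<lambda>X. p v* (X ** M))" for M :: "real^'m^'n"
    unfolding linear_conv_bounded_linear [symmetric]
  proof (rule linearI)
    show "p v* ((X + Y) ** M) = p v* (X ** M) + p v* (Y ** M)" for X Y
      by (simp add: matrix_add_rdistrib vector_matrix_mult_add_rdistrib)
    show "p v* ((c *\<^sub>R X) ** M) = c *\<^sub>R (p v* (X ** M))" for c X
      by (simp add: scalar_matrix_assoc [symmetric] vec_eq_iff vector_matrix_mult_def
          sum_distrib_left mult_ac)
  qed
  define u where "u t = p v* (E t ** B)" for t
  have du: "((\<lambda>t. p v* (E t ** M)) has_vector_derivative - (p v* (E t ** (A ** M)))) (at t within s)"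
    for M :: "real^'m^'n" and t s
    using bounded_linear.has_vector_derivative [OF lin dE, of M t s]
      linear_neg [OF bounded_linear.linear [OF lin, of M], of "E t ** A"]
    by (simp add: matrix_mul_assoc)
  have "continuous_on {0..\<kappa>} u"
    unfolding u_def by (rule continuous_on_vector_derivative) (rule du)
  then obtain \<xi> where \<xi>: "plant_trajectory \<kappa> A B \<xi> u" "\<xi> 0 = 0"
    using plant_trajectory_exists \<open>\<kappa> > 0\<close> by metis
  then have "p \<bullet> \<xi> \<kappa> = 0" by (intro p) (auto simp: reachable_set_def)
  have energy: "((\<lambda>t. - (p \<bullet> (E t *v \<xi> t))) has_real_derivative - (u t \<bullet> u t)) (at t within {0..\<kappa>})"
    if t: "t \<in> {0..\<kappa>}" for t
  proof -
    have "((\<lambda>t. E t *v \<xi> t) has_vector_derivative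
        E t *v (A *v \<xi> t + B *v u t) + (- (E t ** A)) *v \<xi> t) (at t within {0..\<kappa>})"
      using \<xi> t unfolding plant_trajectory_def by (intro has_vector_derivative_matrix_vector_mult dE) auto
    also have "E t *v (A *v \<xi> t + B *v u t) + (- (E t ** A)) *v \<xi> t = (E t ** B) *v u t"
      by (simp add: matrix_vector_right_distrib matrix_vector_mult_uminus_left matrix_vector_mul_assoc)
    finally have "((\<lambda>t. E t *v \<xi> t) has_vector_derivative (E t ** B) *v u t) (at t within {0..\<kappa>})" .
    from has_vector_derivative_inner [OF has_vector_derivative_const [of p] this]
    have "((\<lambda>t. p \<bullet> (E t *v \<xi> t)) has_real_derivative u t \<bullet> u t) (at t within {0..\<kappa>})"
      by (simp add: u_def dot_lmul_matrix)
    then show ?thesis by (rule DERIV_minus)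
  qed
  have u0: "u t = 0" if t: "t \<in> {0..\<kappa>}" for t
  proof -
    have "- (u t \<bullet> u t) = 0"
      by (rule derivative_nonpos_const [OF energy _ \<open>\<kappa> > 0\<close> _ t])
        (simp_all add: E_def \<xi>(2) \<open>p \<bullet> \<xi> \<kappa> = 0\<close>)
    then show ?thesis by simp
  qed
  have "\<forall>t\<in>{0..\<kappa>}. p v* (E t ** (mat_power A j ** B)) = 0"
  proof (induction j)
    case 0
    show ?case using u0 by (simp add: u_def)
  next
    case (Suc j)
    show ?case
    proof
      fix t assume t: "t \<in> {0..\<kappa>}"
      have "((\<lambda>t. p v* (E t ** (mat_power A j ** B))) has_vector_derivative 0) (at t within {0..\<kappa>})"
        by (rule has_vector_derivative_transform [OF t _ has_vector_derivative_const]) (use Suc in auto)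
      moreover have "((\<lambda>t. p v* (E t ** (mat_power A j ** B))) has_vector_derivative
          - (p v* (E t ** (A ** (mat_power A j ** B))))) (at t within {0..\<kappa>})"
        by (rule du)
      ultimately have "- (p v* (E t ** (A ** (mat_power A j ** B)))) = 0"
        using vector_derivative_unique_within_closed_interval
          [of 0 \<kappa> t "\<lambda>t. p v* (E t ** (mat_power A j ** B))"
            "- (p v* (E t ** (A ** (mat_power A j ** B))))" 0] \<open>\<kappa> > 0\<close> t by simp
      then show "p v* (E t ** (mat_power A (Suc j) ** B)) = 0"
        by (simp add: matrix_mul_assoc)
    qed
  qed
  then have "p v* (E 0 ** (mat_power A j ** B)) = 0" using \<open>\<kappa> > 0\<close> by simp
  then show ?thesis by (simp add: E_def)
qed

text \<open>Orthogonality to C (reachable states) says that p C e^(A \<kappa>) annihilates every A^j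
  B. By the eigenvector equation this row is a p, and a is nonzero, so \<open>p\<close> annihilates
  every A^j B; the same equation takes care of the first block of the Hautus matrix.\<close>

lemma hautus_left_kernel:
  fixes A C :: "real^'n^'n" and B :: "real^'m^'n"
  assumes "\<kappa> > 0" and rank: "rank (hautus_mat \<kappa> A B C a) = CARD('n)" and "a \<noteq> 0"
    and p: "p v* complex_mat (C ** mat_exp (\<kappa> *\<^sub>R A)) = a *s p"
    and orth: "\<And>w. w \<in> reachable_set \<kappa> A B \<Longrightarrow> Re_vec p \<bullet> (C *v w) = 0 \<and> Im_vec p \<bullet> (C *v w) = 0"
  shows "p = 0"
proof (rule full_row_rank_left_kernel [OF rank])
  have real: "u v* (C ** mat_exp (\<kappa> *\<^sub>R A)) v* (mat_power A j ** B) = 0"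
    if "\<And>w. w \<in> reachable_set \<kappa> A B \<Longrightarrow> u \<bullet> (C *v w) = 0" for u j
    using reachable_set_normal [OF \<open>\<kappa> > 0\<close>, of A B "u v* C" j] that
    by (simp add: dot_lmul_matrix vector_matrix_mul_assoc matrix_mul_assoc)
  have "a *s (p v* complex_mat (mat_power A j ** B)) = 0" for j
    unfolding scalar_vector_matrix_assoc [symmetric] p [symmetric]
    by (rule complex_vec_eqI) (use real orth in simp_all)
  then have blocks: "p v* complex_mat (mat_power A j ** B) = 0" for j
    using \<open>a \<noteq> 0\<close> by simp
  have eigen: "p v* (complex_mat (C ** mat_exp (\<kappa> *\<^sub>R A)) - mat a) = 0"
    using p by (simp add: vector_matrix_mult_diff_rdistrib vector_mult_mat)
  have "(p v* hautus_mat \<kappa> A B C a) $ j = 0" for j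
  proof (cases j)
    case (Inl l)
    then have "(p v* hautus_mat \<kappa> A B C a) $ j = (p v* (complex_mat (C ** mat_exp (\<kappa> *\<^sub>R A)) - mat a)) $ l"
      by (simp add: vector_matrix_mult_def hautus_mat_def)
    then show ?thesis by (simp add: eigen)
  next
    case (Inr kl)
    obtain k l where "kl = (k, l)" by (cases kl)
    with Inr have "(p v* hautus_mat \<kappa> A B C a) $ j =
        (p v* complex_mat (mat_power A (to_nat_on (UNIV :: 'n set) k) ** B)) $ l"
      by (simp add: vector_matrix_mult_def hautus_mat_def)
    then show ?thesis by (simp add: blocks)
  qed
  then show "p v* hautus_mat \<kappa> A B C a = 0" by (simp add: vec_eq_iff)
qed

text \<open>The control v = u + R^(-1) N' \<xi> produces the same trajectory for \<open>At\<close>.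
  Its running cost is continuous, hence bounded by a constant on the period, and a linear
  \<open>J\<close> is admissible. The bound depends on the trajectory alone and so is uniform in
  \<open>T\<close> and \<open>G\<close>.\<close>

lemma plant_trajectory_bound:
  fixes A Q :: "real^'n^'n" and B N :: "real^'m^'n"
  assumes \<xi>: "plant_trajectory \<kappa> A B \<xi> u"
  shows "\<exists>c. \<forall>T G. value_matrix \<kappa> (A - B ** matrix_inv R ** transpose N) B Q R T G \<longrightarrow>
    \<xi> 0 \<bullet> (G *v \<xi> 0) \<le> c + \<xi> \<kappa> \<bullet> (T *v \<xi> \<kappa>)"
proof -
  let ?At = "A - B ** matrix_inv R ** transpose N"
  define v where "v t = u t + (matrix_inv R ** transpose N) *v \<xi> t" for t
  have d: "(\<xi> has_vector_derivative (?At *v \<xi> t + B *v v t)) (at t within {0..\<kappa>})"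
    if "t \<in> {0..\<kappa>}" for t
    using \<xi> that unfolding plant_trajectory_def v_def
    by (simp add: matrix_vector_mult_diff_rdistrib matrix_vector_right_distrib matrix_vector_mul_assoc
        matrix_mul_assoc)
  have cont: "continuous_on {0..\<kappa>} \<xi>"
    by (rule continuous_on_vector_derivative [OF d])
  then have "continuous_on {0..\<kappa>} v"
    using \<xi> unfolding v_def plant_trajectory_def
    by (intro continuous_intros continuous_on_matrix_vector_mult) auto
  then have "continuous_on {0..\<kappa>} (\<lambda>t. \<xi> t \<bullet> (Q *v \<xi> t) + v t \<bullet> (R *v v t))"
    by (intro continuous_intros continuous_on_matrix_vector_mult cont)
  then have "compact ((\<lambda>t. \<xi> t \<bullet> (Q *v \<xi> t) + v t \<bullet> (R *v v t)) ` {0..\<kappa>})"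
    by (rule compact_continuous_image) auto
  then have "bdd_above ((\<lambda>t. \<xi> t \<bullet> (Q *v \<xi> t) + v t \<bullet> (R *v v t)) ` {0..\<kappa>})"
    by (intro bounded_imp_bdd_above compact_imp_bounded)
  then obtain c where "\<forall>r\<in>(\<lambda>t. \<xi> t \<bullet> (Q *v \<xi> t) + v t \<bullet> (R *v v t)) ` {0..\<kappa>}. r \<le> c"
    unfolding bdd_above_def by blast
  then have c: "\<xi> t \<bullet> (Q *v \<xi> t) + v t \<bullet> (R *v v t) \<le> c" if "t \<in> {0..\<kappa>}" for t
    using that by simp
  have "controlled \<kappa> ?At B Q R \<xi> v (\<lambda>t. c * t)"
    unfolding controlled_def
  proof (intro ballI conjI exI)
    show "((\<lambda>t. c * t) has_real_derivative c) (at t within {0..\<kappa>})" for t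
      by (auto intro!: derivative_eq_intros)
  qed (use d c in auto)
  then have "\<xi> 0 \<bullet> (G *v \<xi> 0) \<le> c * \<kappa> + \<xi> \<kappa> \<bullet> (T *v \<xi> \<kappa>)" if "value_matrix \<kappa> ?At B Q R T G" for T G
    using that [unfolded value_matrix_def, THEN conjunct1, rule_format, of \<xi> v "\<lambda>t. c * t"] by simp
  then show ?thesis by (intro exI allI impI)
qed

lemma congruence_form: "x \<bullet> ((transpose C ** S ** C) *v y) = (C *v x) \<bullet> (S *v (C *v y))"
  for C :: "real^'k^'n"
  by (simp add: inner_matrix_vector_transpose flip: matrix_vector_mul_assoc del: transpose_matrix_vector)

lemma psd_mat_congruence:
  assumes "psd_mat S"
  shows "psd_mat (transpose C ** S ** C)"
proof -
  have "symmetric_mat (transpose C ** S ** C)"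
    using assms by (simp add: psd_mat_def symmetric_mat_def matrix_transpose_mul matrix_mul_assoc)
  then show ?thesis
    using assms unfolding psd_mat_def congruence_form by blast
qed

text \<open>The quadratic forms converge pointwise, and polarisation at the unit vectors recovers
  the entries from them.\<close>

lemma psd_monotone_bounded_convergent:
  fixes G :: "nat \<Rightarrow> real^'n^'n"
  assumes sym: "\<And>k. symmetric_mat (G k)"
    and mono: "\<And>k x. x \<bullet> (G k *v x) \<le> x \<bullet> (G (Suc k) *v x)"
    and bound: "\<And>x. \<exists>c. \<forall>k. x \<bullet> (G k *v x) \<le> c"
  shows "convergent G"
proof -
  define q where "q k x = x \<bullet> (G k *v x)" for k x
  have conv: "convergent (\<lambda>k. q k x)" for x
  proof -
    have "incseq (\<lambda>k. q k x)" using mono by (intro incseq_SucI) (simp add: q_def)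
    moreover obtain c where "\<forall>k. q k x \<le> c" using bound unfolding q_def by blast
    ultimately show ?thesis
      using incseq_convergent unfolding convergent_def by metis
  qed
  have entry: "G k $ i $ j = (q k (axis i 1 + axis j 1) - q k (axis i 1) - q k (axis j 1)) * (1 / 2)" for k i j
  proof -
    have e: "axis i 1 \<bullet> (G k *v axis j 1) = G k $ i $ j" for i j
      by (simp add: inner_axis' matrix_vector_mult_basis column_def)
    have "G k $ j $ i = G k $ i $ j"
      using sym [of k] unfolding symmetric_mat_def transpose_def vec_eq_iff by simp
    then show ?thesis
      by (simp add: q_def matrix_vector_right_distrib inner_add_left inner_add_right e)
  qed
  have "convergent (\<lambda>k. G k $ i $ j)" for i j
    unfolding entry by (intro convergent_mult convergent_diff conv convergent_const)
  then obtain L where "\<And>i j. (\<lambda>k. G k $ i $ j) \<longlonglongrightarrow> L i j"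
    unfolding convergent_def by metis
  then have "G \<longlonglongrightarrow> (\<chi> i j. L i j)"
    by (intro vec_tendstoI) simp
  then show ?thesis unfolding convergent_def by blast
qed

lemma algebraic_periodic_riccati_solvable:
  fixes A At C Qt Rt :: "real^'n^'n" and B N :: "real^'m^'n" and R :: "real^'m^'m"
  assumes P: "block_mat P11 P12 P21 P22 = mat_exp (\<kappa> *\<^sub>R block_mat At (- Rt) (- Qt) (- transpose At))"
    and "\<kappa> > 0" and R: "pd_mat R" and Rt: "Rt = B ** matrix_inv R ** transpose B"
    and At: "At = A - B ** matrix_inv R ** transpose N" and Qt: "psd_mat Qt"
    and hautus: "\<And>s. cmod s \<ge> 1 \<Longrightarrow> rank (hautus_mat \<kappa> A B C s) = CARD('n)"
  shows "\<exists>S0. algebraic_periodic_riccati C P11 P12 P21 P22 S0"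
proof -
  have "\<forall>T\<in>Collect psd_mat. \<exists>G. psd_mat G \<and> T ** (P11 + P12 ** G) = P21 + P22 ** G \<and>
      value_matrix \<kappa> At B Qt R T G"
    using value_matrix_exists [OF P \<open>\<kappa> > 0\<close> R Rt Qt] by blast
  from bchoice [OF this] obtain ric where ric: "\<And>T. psd_mat T \<Longrightarrow> psd_mat (ric T)"
    "\<And>T. psd_mat T \<Longrightarrow> T ** (P11 + P12 ** ric T) = P21 + P22 ** ric T"
    "\<And>T. psd_mat T \<Longrightarrow> value_matrix \<kappa> At B Qt R T (ric T)"
    by blast
  \<comment> \<open>Value iteration: \<open>G k\<close> gives the optimal cost of \<open>k\<close>
    periods, each followed by the jump \<open>C\<close>, with no terminal cost.\<close>
  define G where "G k = ((\<lambda>S. ric (transpose C ** S ** C)) ^^ k) 0" for k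
  have G0: "G 0 = 0" and GSuc: "G (Suc k) = ric (transpose C ** G k ** C)" for k
    by (simp_all add: G_def)
  have psd0: "psd_mat 0"
    unfolding psd_mat_def by (auto intro: symmetric_matI)
  have psd: "psd_mat (G k)" for k
    by (induction k) (simp_all add: G0 psd0 GSuc ric(1) psd_mat_congruence)
  have val: "value_matrix \<kappa> At B Qt R (transpose C ** G k ** C) (G (Suc k))" for k
    unfolding GSuc by (intro ric(3) psd_mat_congruence psd)
  have mono: "x \<bullet> (G k *v x) \<le> x \<bullet> (G (Suc k) *v x)" for k x
  proof (induction k arbitrary: x)
    case 0
    show ?case using psd [of 1] by (simp add: G0 psd_mat_def)
  next
    case (Suc k)
    show ?case
      by (rule value_matrix_mono [OF val val]) (unfold congruence_form, rule Suc)
  qed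
  \<comment> \<open>The state at the end of a period is the free motion plus a reachable state, and
    the jump \<open>C\<close> acts on the sum; hence the choice of \<open>F\<close> and
    \<open>K\<close>.\<close>
  have bound: "\<exists>c. \<forall>k. x \<bullet> (G k *v x) \<le> c" for x
  proof (rule psd_sequence_bounded [where G = G and F = "C ** mat_exp (\<kappa> *\<^sub>R A)"
        and K = "(*v) C ` reachable_set \<kappa> A B", OF _ psd G0])
    show "subspace ((*v) C ` reachable_set \<kappa> A B)"
      by (intro linear_subspace_image subspace_reachable_set) auto
    fix x w assume "w \<in> (*v) C ` reachable_set \<kappa> A B"
    then obtain \<xi> u where w: "w = C *v \<xi> \<kappa>" and \<xi>: "plant_trajectory \<kappa> A B \<xi> u" "\<xi> 0 = 0"
      by (auto simp: reachable_set_def)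
    from plant_trajectory_bound [OF plant_trajectory_add [OF plant_trajectory_free [of _ _ _ x] \<xi>(1)],
        of R N Qt, folded At] obtain c where
      "\<And>T G. value_matrix \<kappa> At B Qt R T G \<Longrightarrow>
        x \<bullet> (G *v x) \<le> c + (mat_exp (\<kappa> *\<^sub>R A) *v x + \<xi> \<kappa>) \<bullet> (T *v (mat_exp (\<kappa> *\<^sub>R A) *v x + \<xi> \<kappa>))"
      by (auto simp: \<xi>(2))
    from this [OF val]
    show "\<exists>c. \<forall>k. x \<bullet> (G (Suc k) *v x) \<le>
        c + ((C ** mat_exp (\<kappa> *\<^sub>R A)) *v x + w) \<bullet> (G k *v ((C ** mat_exp (\<kappa> *\<^sub>R A)) *v x + w))"
      unfolding congruence_form w by (auto simp: matrix_vector_right_distrib matrix_vector_mul_assoc)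
  next
    fix a p assume "1 \<le> cmod a" "p v* complex_mat (C ** mat_exp (\<kappa> *\<^sub>R A)) = a *s p"
      "\<And>w. w \<in> (*v) C ` reachable_set \<kappa> A B \<Longrightarrow> Re_vec p \<bullet> w = 0 \<and> Im_vec p \<bullet> w = 0"
    then show "p = 0"
      by (intro hautus_left_kernel [OF \<open>\<kappa> > 0\<close> hautus, of a p]) auto
  qed
  have "convergent G"
    by (rule psd_monotone_bounded_convergent [OF _ mono bound]) (use psd in \<open>simp add: psd_mat_def\<close>)
  then obtain L where L: "G \<longlonglongrightarrow> L" unfolding convergent_def by blast
  then have L': "(\<lambda>k. G (Suc k)) \<longlonglongrightarrow> L" by (rule LIMSEQ_Suc)
  note tendsto_mult_matrix = bounded_bilinear.tendsto [OF bounded_bilinear_matrix_mult]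
  \<comment> \<open>The end of the period carries \<open>G k\<close> and its beginning
    \<open>G (Suc k)\<close>, with the same limit. In this inverse-free form the equation passes to
    the limit by continuity of the matrix product.\<close>
  have "(\<lambda>k. transpose C ** G k ** C ** (P11 + P12 ** G (Suc k))) \<longlonglongrightarrow>
      transpose C ** L ** C ** (P11 + P12 ** L)"
    by (intro tendsto_mult_matrix tendsto_add tendsto_const L L')
  moreover have "transpose C ** G k ** C ** (P11 + P12 ** G (Suc k)) = P21 + P22 ** G (Suc k)" for k
    unfolding GSuc by (intro ric(2) psd_mat_congruence psd)
  moreover have "(\<lambda>k. P21 + P22 ** G (Suc k)) \<longlonglongrightarrow> P21 + P22 ** L"
    by (intro tendsto_mult_matrix tendsto_add tendsto_const L')
  ultimately have "transpose C ** L ** C ** (P11 + P12 ** L) = P21 + P22 ** L"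
    using LIMSEQ_unique by simp blast
  then show ?thesis unfolding algebraic_periodic_riccati_def by blast
qed

lemma transpose_diff: "transpose (M - M') = transpose M - transpose (M' :: real^'n^'m)"
  by (simp add: transpose_def vec_eq_iff)

text \<open>This Schur complement is the running cost minimised over u, the minimum being attained
  at u = -R^(-1) N' x.\<close>

lemma nonneg_cost_psd:
  assumes Q: "psd_mat Q" and R: "pd_mat R" and cost: "nonneg_cost Q R N"
  shows "psd_mat (Q - N ** matrix_inv R ** transpose N)"
proof -
  have "symmetric_mat (N ** matrix_inv R ** transpose N)"
    using psd_mat_control_weight [OF R, of N] unfolding psd_mat_def by blast
  then have "symmetric_mat (Q - N ** matrix_inv R ** transpose N)"
    using Q unfolding psd_mat_def symmetric_mat_def transpose_diff by simp
  moreover have "0 \<le> x \<bullet> ((Q - N ** matrix_inv R ** transpose N) *v x)" for x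
  proof -
    define z where "z = matrix_inv R *v (transpose N *v x)"
    have Rz: "R *v z = transpose N *v x" unfolding z_def by (rule pd_mat_inverse [OF R])
    have Nz: "x \<bullet> (N *v z) = z \<bullet> (transpose N *v x)"
      unfolding inner_matrix_vector_transpose [of x N] by (rule inner_commute)
    have "0 \<le> x \<bullet> (Q *v x) + (- z) \<bullet> (R *v (- z)) + 2 * (x \<bullet> (N *v (- z)))"
      using cost unfolding nonneg_cost_def by blast
    also have "\<dots> = x \<bullet> (Q *v x) - x \<bullet> (N *v z)"
      by (simp add: matrix_vector_mult_uminus_right Rz Nz del: transpose_matrix_vector)
    also have "\<dots> = x \<bullet> ((Q - N ** matrix_inv R ** transpose N) *v x)"
      by (simp add: z_def matrix_vector_mult_diff_rdistrib inner_diff_right matrix_vector_mul_assoc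
          matrix_mul_assoc del: transpose_matrix_vector)
    finally show ?thesis .
  qed
  ultimately show ?thesis by (simp add: psd_mat_def)
qed

theorem theorem8:
  fixes \<kappa> :: real
    and A C Q At Rt Qt P11 P12 P21 P22 :: "real^'n^'n"
    and B N :: "real^'m^'n"
    and R :: "real^'m^'m"
    and b :: "real^'n"
    and Z :: "real^('n + 'n)^('n + 'n)"
  assumes "\<kappa> > 0"
    and "psd_mat Q"
    and "pd_mat R"
    and "Qt = Q - N ** matrix_inv R ** transpose N"
    and "At = A - B ** matrix_inv R ** transpose N"
    and "Rt = B ** matrix_inv R ** transpose B"
    and "Z = block_mat At (- Rt) (- Qt) (- transpose At)"
    and "block_mat P11 P12 P21 P22 = mat_exp (\<kappa> *\<^sub>R Z)"
  shows
    "(\<forall>S. periodic_riccati \<kappa> At Rt Qt C S \<longrightarrow>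
          algebraic_periodic_riccati C P11 P12 P21 P22 (S 0)) \<and>
     (\<forall>S S'. periodic_riccati \<kappa> At Rt Qt C S \<and> periodic_riccati \<kappa> At Rt Qt C S' \<and> S 0 = S' 0 \<longrightarrow>
          (\<forall>t\<in>{0..\<kappa>}. S t = S' t)) \<and>
     (\<forall>S. riccati_ode \<kappa> At Rt Qt S \<and> algebraic_periodic_riccati C P11 P12 P21 P22 (S 0) \<longrightarrow>
          periodic_riccati \<kappa> At Rt Qt C S) \<and>
     (nonneg_cost Q R N \<longrightarrow>
       (\<forall>S0. symmetric_mat S0 \<and> algebraic_periodic_riccati C P11 P12 P21 P22 S0 \<longrightarrow>
          (\<exists>S. periodic_riccati \<kappa> At Rt Qt C S \<and> S 0 = S0))) \<and>
     (\<forall>S \<Phi>.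
        periodic_riccati \<kappa> At Rt Qt C S \<and>
        fundamental_matrix \<kappa> (\<lambda>t. - transpose At + S t ** Rt) \<Phi> \<and>
        invertible (\<Phi> \<kappa> 0 - transpose C) \<longrightarrow>
          (\<exists>c. periodic_linear \<kappa> At Rt C b S c) \<and>
          (\<forall>c. periodic_linear \<kappa> At Rt C b S c \<longrightarrow>
             c 0 = matrix_inv (\<Phi> \<kappa> 0 - transpose C) *v
                     integral {0..\<kappa>} (\<lambda>\<tau>. (\<Phi> \<kappa> \<tau> ** S \<tau>) *v b))) \<and>
     (nonneg_cost Q R N \<and>
      (\<forall>s::complex. cmod s \<ge> 1 \<longrightarrow> rank (hautus_mat \<kappa> A B C s) = CARD('n)) \<longrightarrow>
        (\<exists>S0. algebraic_periodic_riccati C P11 P12 P21 P22 S0))"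
proof -
  note P = assms(8) [unfolded assms(7)]
  have S: "riccati_ode \<kappa> At Rt Qt S" if "periodic_riccati \<kappa> At Rt Qt C S" for S
    using that by (simp add: periodic_riccati_def)
  have Rt: "psd_mat Rt" unfolding assms(6) by (rule psd_mat_control_weight [OF assms(3)])
  have Qt: "psd_mat Qt" if "nonneg_cost Q R N"
    unfolding assms(4) by (rule nonneg_cost_psd [OF assms(2,3) that])
  show ?thesis
  proof (intro conjI)
    show "\<forall>S. periodic_riccati \<kappa> At Rt Qt C S \<longrightarrow>
        algebraic_periodic_riccati C P11 P12 P21 P22 (S 0)"
    proof (intro allI impI)
      fix S assume per: "periodic_riccati \<kappa> At Rt Qt C S"
      then show "algebraic_periodic_riccati C P11 P12 P21 P22 (S 0)"
        using riccati_ode_terminal_iff [OF P S [OF per] assms(1), of C]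
        by (simp only: periodic_riccati_def)
    qed
    show "\<forall>S S'. periodic_riccati \<kappa> At Rt Qt C S \<and> periodic_riccati \<kappa> At Rt Qt C S' \<and> S 0 = S' 0 \<longrightarrow>
        (\<forall>t\<in>{0..\<kappa>}. S t = S' t)"
      by (intro allI impI ballI, elim conjE, rule riccati_ode_unique [OF S S])
    show "\<forall>S. riccati_ode \<kappa> At Rt Qt S \<and> algebraic_periodic_riccati C P11 P12 P21 P22 (S 0) \<longrightarrow>
        periodic_riccati \<kappa> At Rt Qt C S"
    proof (intro allI impI, elim conjE)
      fix S assume "riccati_ode \<kappa> At Rt Qt S" "algebraic_periodic_riccati C P11 P12 P21 P22 (S 0)"
      then show "periodic_riccati \<kappa> At Rt Qt C S"
        using riccati_ode_terminal_iff [OF P _ assms(1), of S C]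
        by (simp only: periodic_riccati_def)
    qed
    show "nonneg_cost Q R N \<longrightarrow>
       (\<forall>S0. symmetric_mat S0 \<and> algebraic_periodic_riccati C P11 P12 P21 P22 S0 \<longrightarrow>
          (\<exists>S. periodic_riccati \<kappa> At Rt Qt C S \<and> S 0 = S0))"
      by (intro allI impI, elim conjE, rule periodic_riccati_exists [OF P Rt Qt _ assms(1)])
    show "\<forall>S \<Phi>.
        periodic_riccati \<kappa> At Rt Qt C S \<and>
        fundamental_matrix \<kappa> (\<lambda>t. - transpose At + S t ** Rt) \<Phi> \<and>
        invertible (\<Phi> \<kappa> 0 - transpose C) \<longrightarrow>
          (\<exists>c. periodic_linear \<kappa> At Rt C b S c) \<and>
          (\<forall>c. periodic_linear \<kappa> At Rt C b S c \<longrightarrow>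
             c 0 = matrix_inv (\<Phi> \<kappa> 0 - transpose C) *v
                     integral {0..\<kappa>} (\<lambda>\<tau>. (\<Phi> \<kappa> \<tau> ** S \<tau>) *v b))"
      by (intro allI impI, elim conjE, rule periodic_linear_solution [OF S assms(1)])
    show "nonneg_cost Q R N \<and>
      (\<forall>s::complex. cmod s \<ge> 1 \<longrightarrow> rank (hautus_mat \<kappa> A B C s) = CARD('n)) \<longrightarrow>
        (\<exists>S0. algebraic_periodic_riccati C P11 P12 P21 P22 S0)"
      by (intro impI, elim conjE, rule algebraic_periodic_riccati_solvable [OF P assms(1,3,6,5) Qt]) auto
  qed
qed

end
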